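(* Let $(X_i)_{i\ge 1}$ be i.i.d. real random variables with $\mathbb E X_1=0$, $\mathbb E X_1^2=\sigma^2\in(0,\infty)$ and $\mathbb E|X_1|^{2+\delta}<\infty$ for some $\delta>0$. Then there exists a constant $c_\delta>0$ such that for any $n\ge1$, $x>n^{\frac12-\frac{\delta}{2(3+\delta)}}$ and $t\in\mathbb R_+$, $$\left|\mathbb P\Big(\frac{x+S_n}{\sigma\sqrt n}\le t,\ \tau_x>n\Big)-\int_0^t\psi\Big(s,\frac{x}{\sigma\sqrt n}\Big)\,ds\right|\le c_\delta\,n^{-\frac{\delta}{2(3+\delta)}}.$$ In particular, for all $n\ge1$ and $x>n^{\frac12-\frac{\delta}{2(3+\delta)}}$, $$\left|\mathbb P(\tau_x>n)-\Big(2\Phi\Big(\frac{x}{\sigma\sqrt n}\Big)-1\Big)\right|\le c_\delta\,n^{-\frac{\delta}{2(3+\delta)}}.$$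
   Context: Notation: $\mathbb R_+=[0,\infty)$; $S_n=\sum_{i=1}^n X_i$; for $x\ge0$, $\tau_x=\inf\{k\ge1:\ x+S_k<0\}$; $\psi(s,x)=\frac1{\sqrt{2\pi}}\big(e^{-(s-x)^2/2}-e^{-(s+x)^2/2}\big)$ for $s,x\in\mathbb R$; $\Phi$ is the standard normal distribution function. *)

theory Defs
  imports "HOL-Probability.Probability"
begin

definition walk :: "(nat \<Rightarrow> 'a \<Rightarrow> real) \<Rightarrow> nat \<Rightarrow> 'a \<Rightarrow> real" where
  "walk X n \<omega> = (\<Sum>i=1..n. X i \<omega>)"

text \<open>The infimum is taken in the extended naturals, so the exit time is \<open>\<infinity>\<close> on
  paths that never become negative.\<close>

definition exit_time :: "(nat \<Rightarrow> 'a \<Rightarrow> real) \<Rightarrow> real \<Rightarrow> 'a \<Rightarrow> enat" where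
  "exit_time X x \<omega> = Inf (enat ` {k. 1 \<le> k \<and> x + walk X k \<omega> < 0})"

definition \<psi> :: "real \<Rightarrow> real \<Rightarrow> real" where
  "\<psi> s x = 1 / sqrt (2 * pi) * (exp (- (s - x)\<^sup>2 / 2) - exp (- (s + x)\<^sup>2 / 2))"

abbreviation \<Phi> :: "real \<Rightarrow> real" where
  "\<Phi> \<equiv> cdf std_normal_distribution"

end

theory Submission
  imports Defs
begin

text \<open>
  Dividing by \<open>\<sigma>\<close>, let the steps have variance one. Let \<open>u\<^sub>b (s, y)\<close> be the solution of the heat equation
  whose initial value is the odd extension of the indicator of \<open>[0, b]\<close>. By the reflection principle
  it is, for \<open>y \<ge> 0\<close>, the probability that a Brownian motion started at \<open>y\<close> and killed at zero is
  alive and at most \<open>b\<close> at time \<open>s\<close>; \<open>u\<^sub>t (1, x)\<close> is the integral of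
  \<open>\<psi> s x\<close> over \<open>s \<in> [0, t]\<close>, and the claim compares \<open>P (x + S\<^sub>n \<le> b, \<tau>\<^sub>x > n)\<close> with \<open>u\<^sub>b (n, x)\<close>. No coupling
  with Brownian motion is used. Instead, the expectation of \<open>u (m + n - k, c + S\<^sub>k)\<close> on the event
  \<open>\<tau>\<^sub>x > k\<close> is followed from \<open>k = 0\<close> to \<open>k = n\<close> by the Lindeberg method, for a smoothing time \<open>m\<close>. Put
  \<open>\<epsilon> = \<delta> / (2 * (3 + \<delta>))\<close> and \<open>a = n powr (1 / 2 - \<epsilon>)\<close>.

  At the boundary only signs are needed. With \<open>c = x\<close> the odd function \<open>u\<close> is nonpositive at the
  exit time, which gives a lower bound (\<open>flow_lower\<close>). With \<open>c = x + a\<close> it is nonnegative at the exit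
  time unless some step exceeds \<open>a\<close>, which gives an upper bound (\<open>flow_upper\<close>); by Markov's inequality
  a step that large has probability of order \<open>n * a powr - (2 + \<delta>) = n powr - \<epsilon>\<close>, and the shift changes
  \<open>u\<close> by at most a multiple of \<open>a / sqrt n = n powr - \<epsilon>\<close>.

  In the interior, replacing one step by a standard normal variable costs at most a multiple of
  \<open>s powr - (1 + p / 2)\<close> with \<open>s = m + n - k - 1\<close> and \<open>p = min 1 \<delta>\<close>, times the average of a Gaussian
  kernel of variance \<open>2 * s\<close> over the law of \<open>S\<^sub>k\<close> (\<open>heat_step\<close>). That average is of order \<open>sqrt (s / n)\<close>, as
  the characteristic function of the steps shows (\<open>walk_concentration\<close>), and the errors sum to
  \<open>O (n powr - \<epsilon>)\<close> for every \<open>\<epsilon> < p / 2\<close> (\<open>lindeberg_error_sum\<close>). Without the gain from concentration the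
  sum would be too large for large \<open>\<delta>\<close>. The second claim is the limit \<open>b \<rightarrow> \<infinity>\<close> of the first.
\<close>

section \<open>The normal distribution function and its derivatives\<close>

interpretation std_normal: real_distribution std_normal_distribution
  by (rule real_dist_normal_dist)

lemma measure_std_normal_Ioc:
  assumes "a \<le> b"
  shows "\<Phi> b - \<Phi> a = integral {a..b} std_normal_density"
proof -
  have cont: "continuous_on {a..b} std_normal_density"
    unfolding normal_density_def by (intro continuous_intros) auto
  have int: "set_integrable lborel {a..b} std_normal_density"
    by (rule borel_integrable_atLeastAtMost'[OF cont])
  have "\<Phi> b - \<Phi> a = measure std_normal_distribution {a<..b}"
  proof (cases "a = b")
    case False
    then show ?thesis using std_normal.cdf_diff_eq[of a b] assms by simp
  qed simp
  also have "\<dots> = (LINT x|std_normal_distribution. indicator {a<..b} x)"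
    by simp
  also have "\<dots> = (LINT x|lborel. std_normal_density x * indicator {a<..b} x)"
    by (subst integral_density) auto
  also have "\<dots> = (LINT x|lborel. indicator {a..b} x * std_normal_density x)"
    by (rule integral_cong_AE) (use AE_lborel_singleton[of a] in \<open>auto split: split_indicator\<close>)
  also have "\<dots> = (LINT x:{a..b}|lborel. std_normal_density x)"
    by (simp add: set_lebesgue_integral_def)
  also have "\<dots> = integral {a..b} std_normal_density"
    by (rule set_borel_integral_eq_integral[OF int])
  finally show ?thesis .
qed

lemma Phi_deriv: "(\<Phi> has_real_derivative std_normal_density x) (at x)"
proof -
  have cont: "continuous_on {x - 1..x + 1} std_normal_density"
    unfolding normal_density_def by (intro continuous_intros) auto
  have "((\<lambda>y. integral {x-1..y} std_normal_density) has_real_derivative std_normal_density x) (at x within {x-1..x+1})"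
    by (rule integral_has_real_derivative[OF cont]) auto
  then have "((\<lambda>y. integral {x-1..y} std_normal_density) has_real_derivative std_normal_density x) (at x)"
    by (simp add: at_within_Icc_at)
  then have "((\<lambda>y. \<Phi> (x-1) + integral {x-1..y} std_normal_density) has_real_derivative std_normal_density x) (at x)"
    by (auto intro!: derivative_eq_intros)
  then show ?thesis
  proof (rule has_field_derivative_transform_within[where d=1])
    fix y :: real assume "dist y x < 1"
    then have "x - 1 \<le> y" by (auto simp: dist_real_def)
    from measure_std_normal_Ioc[OF this]
    show "\<Phi> (x - 1) + integral {x - 1..y} std_normal_density = \<Phi> y" by simp
  qed auto
qed

lemmas Phi_deriv' [derivative_intros] = DERIV_chain2[OF Phi_deriv]

lemma std_normal_density_deriv [derivative_intros]:
  assumes "(f has_real_derivative f') (at x)"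
  shows "((\<lambda>x. std_normal_density (f x)) has_real_derivative (- f x * std_normal_density (f x)) * f') (at x)"
proof -
  have "(std_normal_density has_real_derivative (- y * std_normal_density y)) (at y)" for y
    unfolding normal_density_def by (auto intro!: derivative_eq_intros simp: field_simps power2_eq_square)
  from DERIV_chain2[OF this assms] show ?thesis .
qed

lemma isCont_Phi [continuous_intros]: "isCont f x \<Longrightarrow> isCont (\<lambda>x. \<Phi> (f x)) x"
  using isCont_o2[OF _ DERIV_isCont[OF Phi_deriv]] by blast

lemma borel_measurable_Phi [measurable]: "\<Phi> \<in> borel_measurable borel"
  by (intro borel_measurable_continuous_onI continuous_at_imp_continuous_on) (auto intro: isCont_Phi)

lemma std_normal_density_le: "std_normal_density w \<le> exp (- w\<^sup>2 / 2)"
proof -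
  have "1 \<le> sqrt (2 * pi)" using pi_gt3 by (simp add: real_le_rsqrt)
  then have "1 / sqrt (2 * pi) \<le> 1" by simp
  from mult_right_mono[OF this, of "exp (- w\<^sup>2 / 2)"] show ?thesis
    unfolding std_normal_density_def by simp
qed

lemma std_normal_density_le_1: "std_normal_density w \<le> 1"
  by (rule order_trans[OF std_normal_density_le]) simp

lemma Phi_lipschitz: "\<bar>\<Phi> x - \<Phi> y\<bar> \<le> \<bar>x - y\<bar>"
proof -
  have *: "\<Phi> x - \<Phi> y \<le> x - y \<and> 0 \<le> \<Phi> x - \<Phi> y" if lt: "y < x" for x y
  proof -
    obtain z where "\<Phi> x - \<Phi> y = (x - y) * std_normal_density z"
      using MVT2[OF lt, of \<Phi> std_normal_density] Phi_deriv by auto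
    then show ?thesis using std_normal_density_le_1[of z] lt
      by (simp add: mult_left_le)
  qed
  show ?thesis using *[of x y] *[of y x] by (cases x y rule: linorder_cases) auto
qed

lemma Phi_minus: "\<Phi> (- x) = 1 - \<Phi> x"
proof -
  have even: "std_normal_density (- x) = std_normal_density x" for x
    by (simp add: normal_density_def)
  have "((\<lambda>x. \<Phi> x + \<Phi> (- x)) has_real_derivative 0) (at x)" for x
    by (auto intro!: derivative_eq_intros simp: even)
  then have "\<Phi> x + \<Phi> (- x) = \<Phi> y + \<Phi> (- y)" for x y
    using DERIV_const_ratio_const2 DERIV_isconst_all by blast
  then have const: "(\<lambda>n::nat. \<Phi> (real n) + \<Phi> (- real n)) = (\<lambda>n. \<Phi> x + \<Phi> (- x))" by blast
  have "(\<lambda>n::nat. \<Phi> (real n) + \<Phi> (- real n)) \<longlonglongrightarrow> 1 + 0"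
    by (intro tendsto_add std_normal.cdf_lim_infty_prob std_normal.cdf_lim_neg_infty)
  then show ?thesis unfolding const using LIMSEQ_const_iff by (metis add.commute add.right_neutral add_diff_cancel_right')
qed

text \<open>The distribution function of a centred normal law with variance \<open>s\<close>. As a function of
  \<open>(s, y)\<close> it solves the heat equation \<open>\<partial>\<^sub>s u = \<partial>\<^sub>y\<^sub>y u / 2\<close>. The functions \<open>heat1\<close>, \<open>heat2\<close>, \<open>heat3\<close> are its
  first three derivatives in \<open>y\<close>.\<close>

definition heat :: "real \<Rightarrow> real \<Rightarrow> real" where
  "heat s y = \<Phi> (y / sqrt s)"

definition heat1 :: "real \<Rightarrow> real \<Rightarrow> real" where
  "heat1 s y = std_normal_density (y / sqrt s) / sqrt s"

definition heat2 :: "real \<Rightarrow> real \<Rightarrow> real" where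
  "heat2 s y = - (y / sqrt s) * std_normal_density (y / sqrt s) / s"

definition heat3 :: "real \<Rightarrow> real \<Rightarrow> real" where
  "heat3 s y = ((y / sqrt s)\<^sup>2 - 1) * std_normal_density (y / sqrt s) / (s * sqrt s)"

lemma heat_measurable [measurable]:
  "heat s \<in> borel_measurable borel" "heat1 s \<in> borel_measurable borel"
  "heat2 s \<in> borel_measurable borel" "heat3 s \<in> borel_measurable borel"
  unfolding heat_def[abs_def] heat1_def[abs_def] heat2_def[abs_def] heat3_def[abs_def] by measurable

lemma heat_deriv:
  assumes "s > 0"
  shows "(heat s has_real_derivative heat1 s y) (at y)"
    "(heat1 s has_real_derivative heat2 s y) (at y)"
    "(heat2 s has_real_derivative heat3 s y) (at y)"
proof -
  define r where "r = sqrt s"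
  have r: "s = r\<^sup>2" "sqrt (r\<^sup>2) = r" "r > 0" using assms by (auto simp: r_def)
  show "(heat s has_real_derivative heat1 s y) (at y)"
    "(heat1 s has_real_derivative heat2 s y) (at y)"
    "(heat2 s has_real_derivative heat3 s y) (at y)"
    unfolding heat_def[abs_def] heat1_def[abs_def] heat2_def[abs_def] heat3_def[abs_def] r(1,2)
    using r(3) by (auto intro!: derivative_eq_intros simp: field_simps power2_eq_square)
qed

lemma heat_nonneg: "0 \<le> heat s y" and heat_le_1: "heat s y \<le> 1"
  by (auto simp: heat_def std_normal.cdf_nonneg std_normal.cdf_bounded_prob)

lemma heat1_bound:
  assumes "s > 0"
  shows "\<bar>heat1 s y\<bar> \<le> 1 / sqrt s"
  using assms std_normal_density_le_1[of "y / sqrt s"] by (simp add: heat1_def divide_right_mono)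

text \<open>The polynomial factors of the derivatives are absorbed by doubling the variance of the
  Gaussian factor.\<close>

lemma heat2_bound:
  assumes "s > 0"
  shows "\<bar>heat2 s y\<bar> \<le> 4 / s * exp (- y\<^sup>2 / (4 * s))"
proof -
  define w where "w = y / sqrt s"
  have w2: "w\<^sup>2 = y\<^sup>2 / s" using assms by (simp add: w_def power_divide)
  have "\<bar>w\<bar> \<le> 1 + w\<^sup>2 / 4"
    using zero_le_power2[of "\<bar>w\<bar> / 2 - 1"] by (simp add: power2_eq_square field_simps)
  also have "\<dots> \<le> exp (w\<^sup>2 / 4)" by (rule exp_ge_add_one_self)
  finally have "\<bar>w\<bar> * std_normal_density w \<le> exp (w\<^sup>2 / 4) * exp (- w\<^sup>2 / 2)"
    by (intro mult_mono std_normal_density_le) auto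
  also have "\<dots> = exp (- w\<^sup>2 / 4)" by (simp add: exp_add[symmetric])
  finally have "\<bar>w\<bar> * std_normal_density w / s \<le> 4 * exp (- w\<^sup>2 / 4) / s"
    using assms by (intro divide_right_mono) (auto intro: order_trans)
  then show ?thesis unfolding heat2_def w_def[symmetric] using assms
    by (simp add: abs_mult w2 field_simps)
qed

lemma heat3_bound:
  assumes "s > 0"
  shows "\<bar>heat3 s y\<bar> \<le> 4 / (s * sqrt s) * exp (- y\<^sup>2 / (4 * s))"
proof -
  define w where "w = y / sqrt s"
  have w2: "w\<^sup>2 = y\<^sup>2 / s" using assms by (simp add: w_def power_divide)
  have "\<bar>w\<^sup>2 - 1\<bar> \<le> 4 * (1 + w\<^sup>2 / 4)" by (simp add: abs_le_iff) 
  also have "\<dots> \<le> 4 * exp (w\<^sup>2 / 4)" by (intro mult_left_mono exp_ge_add_one_self) simp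
  finally have "\<bar>w\<^sup>2 - 1\<bar> * std_normal_density w \<le> 4 * exp (w\<^sup>2 / 4) * exp (- w\<^sup>2 / 2)"
    by (intro mult_mono std_normal_density_le) auto
  also have "\<dots> = 4 * exp (- w\<^sup>2 / 4)" by (simp add: exp_add[symmetric])
  finally have "\<bar>w\<^sup>2 - 1\<bar> * std_normal_density w / (s * sqrt s) \<le> 4 * exp (- w\<^sup>2 / 4) / (s * sqrt s)"
    using assms by (intro divide_right_mono) auto
  moreover have "exp (- w\<^sup>2 / 4) = exp (- y\<^sup>2 / (4 * s))" by (simp add: w2)
  moreover have "\<bar>heat3 s y\<bar> = \<bar>w\<^sup>2 - 1\<bar> * std_normal_density w / (s * sqrt s)"
    using assms by (simp add: heat3_def w_def abs_mult)
  ultimately show ?thesis by (simp add: ac_simps)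
qed

text \<open>The semigroup property: adding an independent normal variable of variance \<open>r\<close> adds \<open>r\<close> to
  the variance.\<close>

lemma heat_semigroup:
  assumes s: "s > 0" and r: "r > 0"
  shows "(LINT h|std_normal_distribution. heat s (y + sqrt r * h)) = heat (s + r) y"
proof -
  let ?N = std_normal_distribution
  interpret P: pair_prob_space ?N ?N ..
  have sqs: "sqrt s > 0" "sqrt r > 0" "sqrt (s + r) > 0" using s r by auto
  have fst: "distr (?N \<Otimes>\<^sub>M ?N) ?N fst = ?N" by (rule std_normal.distr_pair_fst)
  have snd: "distr (?N \<Otimes>\<^sub>M ?N) ?N snd = ?N"
  proof -
    have "distr (?N \<Otimes>\<^sub>M ?N) ?N fst = distr (distr (?N \<Otimes>\<^sub>M ?N) (?N \<Otimes>\<^sub>M ?N) (\<lambda>(x, y). (y, x))) ?N fst"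
      using P.distr_pair_swap by simp
    also have "\<dots> = distr (?N \<Otimes>\<^sub>M ?N) ?N snd"
      by (subst distr_distr) (auto simp: o_def case_prod_beta intro!: distr_cong)
    finally show ?thesis using fst by simp
  qed
  have Nb: "distr (?N \<Otimes>\<^sub>M ?N) borel f = distr (?N \<Otimes>\<^sub>M ?N) ?N f" for f
    by (rule distr_cong) auto
  have Nl: "distr (?N \<Otimes>\<^sub>M ?N) lborel f = distr (?N \<Otimes>\<^sub>M ?N) ?N f" for f
    by (rule distr_cong) auto
  \<comment> \<open>Both sides are the probability that \<open>sqrt s * g - sqrt r * h \<le> y\<close> for independent standard normal
    \<open>g\<close> and \<open>h\<close>.\<close>
  have d1: "distributed (?N \<Otimes>\<^sub>M ?N) lborel fst std_normal_density"
    unfolding distributed_def Nl fst by auto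
  have d2: "distributed (?N \<Otimes>\<^sub>M ?N) lborel snd std_normal_density"
    unfolding distributed_def Nl snd by auto
  have e1: "distributed (?N \<Otimes>\<^sub>M ?N) lborel (\<lambda>x. sqrt s * fst x) (normal_density 0 (sqrt s))"
    using P.normal_density_affine[OF d1, of "sqrt s" 0] sqs by auto
  have e2: "distributed (?N \<Otimes>\<^sub>M ?N) lborel (\<lambda>x. - sqrt r * snd x) (normal_density 0 (sqrt r))"
    using P.normal_density_affine[OF d2, of "- sqrt r" 0] sqs by auto
  have sb: "sets (?N \<Otimes>\<^sub>M ?N) = sets (borel \<Otimes>\<^sub>M borel)" by (intro sets_pair_measure_cong) auto
  have "P.indep_var borel fst borel snd"
    unfolding P.indep_var_distribution_eq Nb fst snd
    by (simp add: distr_id2[OF sb[symmetric], unfolded id_def] sb)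
  from P.indep_var_compose[OF this, of "\<lambda>x. sqrt s * x" borel "\<lambda>x. - sqrt r * x" borel]
  have ind: "P.indep_var borel (\<lambda>x. sqrt s * fst x) borel (\<lambda>x. - sqrt r * snd x)"
    by (simp add: o_def)
  have e3: "distributed (?N \<Otimes>\<^sub>M ?N) lborel (\<lambda>x. sqrt s * fst x - sqrt r * snd x) (normal_density 0 (sqrt (s + r)))"
    using P.add_indep_normal[OF ind _ _ e1 e2] sqs s r by simp
  have e4: "distributed (?N \<Otimes>\<^sub>M ?N) lborel (\<lambda>x. (sqrt s * fst x - sqrt r * snd x) / sqrt (s + r)) std_normal_density"
    using P.normal_density_affine[OF e3, of "1 / sqrt (s + r)" 0] sqs by simp
  have "heat (s + r) y = measure (distr (?N \<Otimes>\<^sub>M ?N) lborel (\<lambda>x. (sqrt s * fst x - sqrt r * snd x) / sqrt (s + r))) {..y / sqrt (s + r)}"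
    unfolding heat_def cdf_def2 using e4 by (simp add: distributed_def)
  also have "\<dots> = measure (?N \<Otimes>\<^sub>M ?N) {x \<in> space (?N \<Otimes>\<^sub>M ?N). sqrt s * fst x - sqrt r * snd x \<le> y}"
    by (subst measure_distr) (use sqs in \<open>auto simp: vimage_def divide_le_cancel intro!: arg_cong[where f="measure _"]\<close>)
  also have "\<dots> = (LINT x|(?N \<Otimes>\<^sub>M ?N). indicat_real {x. sqrt s * fst x - sqrt r * snd x \<le> y} x)"
    by (subst Bochner_Integration.integral_indicator) (auto intro!: arg_cong[where f="measure _"])
  also have "\<dots> = (LINT h|?N. (LINT g|?N. indicat_real {x. sqrt s * fst x - sqrt r * snd x \<le> y} (g, h)))"
    by (rule P.integral_snd[symmetric, of "\<lambda>g h. indicat_real {x. sqrt s * fst x - sqrt r * snd x \<le> y} (g, h)", unfolded case_prod_eta])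
       (auto intro!: P.integrable_const_bound[of _ 1])
  also have "\<dots> = (LINT h|?N. heat s (y + sqrt r * h))"
  proof (rule Bochner_Integration.integral_cong[OF refl])
    fix h
    have "(LINT g|?N. indicat_real {x. sqrt s * fst x - sqrt r * snd x \<le> y} (g, h)) = (LINT g|?N. indicat_real {..(y + sqrt r * h) / sqrt s} g)"
      using sqs by (intro Bochner_Integration.integral_cong) (auto simp: indicator_def field_simps)
    then show "(LINT g|?N. indicat_real {x. sqrt s * fst x - sqrt r * snd x \<le> y} (g, h)) = heat s (y + sqrt r * h)"
      by (simp add: heat_def cdf_def)
  qed
  finally show ?thesis by simp
qed

lemma heat_mono: "s > 0 \<Longrightarrow> x \<le> y \<Longrightarrow> heat s x \<le> heat s y"
  unfolding heat_def by (intro std_normal.cdf_nondecreasing divide_right_mono) auto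

lemma heat_minus: "heat s (- y) = 1 - heat s y"
  unfolding heat_def by (simp add: Phi_minus)

lemma heat_lipschitz: "s > 0 \<Longrightarrow> \<bar>heat s x - heat s y\<bar> \<le> \<bar>x - y\<bar> / sqrt s"
  using Phi_lipschitz[of "x / sqrt s" "y / sqrt s"]
  by (simp add: heat_def diff_divide_distrib[symmetric])

lemma integrable_std_normal_bounded:
  assumes "f \<in> borel_measurable borel" "\<And>x. \<bar>f x\<bar> \<le> B"
  shows "integrable std_normal_distribution (f :: real \<Rightarrow> real)"
  by (rule std_normal.integrable_const_bound[of _ B]) (use assms in auto)

lemma std_normal_abs_moment: "(LINT h|std_normal_distribution. \<bar>h\<bar>) \<le> 1"
proof -
  have 2: "(LINT h|std_normal_distribution. h\<^sup>2) = 1" "integrable std_normal_distribution (\<lambda>h. h\<^sup>2)"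
    using std_normal_distribution_even_moments[of 1] by simp_all
  have "(LINT h|std_normal_distribution. \<bar>h\<bar>) \<le> (LINT h|std_normal_distribution. (1 + h\<^sup>2) / 2)"
  proof (rule integral_mono)
    show "integrable std_normal_distribution abs"
      using integrable_std_normal_distribution_moment[of 1] by (simp add: integrable_abs)
    fix h :: real
    show "\<bar>h\<bar> \<le> (1 + h\<^sup>2) / 2"
      using zero_le_power2[of "\<bar>h\<bar> - 1"] by (simp add: power2_eq_square field_simps)
  qed (use 2 in auto)
  also have "\<dots> = 1" using 2 by (simp add: std_normal.prob_space[simplified])
  finally show ?thesis .
qed

text \<open>By the semigroup property, the flow at time \<open>s + r\<close> is an average of the flow at time \<open>s\<close> over
  displacements of mean size at most \<open>sqrt r\<close>.\<close>

lemma heat_time_change: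
  assumes s: "s > 0" and r: "r > 0"
  shows "\<bar>heat (s + r) y - heat s y\<bar> \<le> sqrt r / sqrt s"
proof -
  let ?N = std_normal_distribution
  have [simp]: "integrable ?N (\<lambda>h. heat s (y + sqrt r * h))"
    by (rule integrable_std_normal_bounded[of _ 1]) (auto simp: heat_nonneg heat_le_1)
  have "heat (s + r) y - heat s y = (LINT h|?N. heat s (y + sqrt r * h) - heat s y)"
    using s r by (simp add: heat_semigroup std_normal.prob_space[simplified])
  also have "\<bar>\<dots>\<bar> \<le> (LINT h|?N. \<bar>heat s (y + sqrt r * h) - heat s y\<bar>)"
    by (rule integral_abs_bound)
  also have "\<dots> \<le> (LINT h|?N. sqrt r / sqrt s * \<bar>h\<bar>)"
  proof (rule integral_mono)
    show "integrable ?N (\<lambda>h. sqrt r / sqrt s * \<bar>h\<bar>)"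
      using integrable_std_normal_distribution_moment[of 1] by (auto simp: integrable_abs)
    fix h :: real
    show "\<bar>heat s (y + sqrt r * h) - heat s y\<bar> \<le> sqrt r / sqrt s * \<bar>h\<bar>"
      using heat_lipschitz[OF s, of "y + sqrt r * h" y] r by (simp add: abs_mult)
  qed simp
  also have "\<dots> = sqrt r / sqrt s * (LINT h|?N. \<bar>h\<bar>)" by simp
  also have "\<dots> \<le> sqrt r / sqrt s * 1"
    using s r by (intro mult_left_mono std_normal_abs_moment) auto
  finally show ?thesis by simp
qed

lemma std_normal_tail:
  "\<exists>C>0. \<forall>z>0. measure std_normal_distribution {h. z \<le> \<bar>h\<bar>} \<le> C / z ^ (2 * k)"
proof -
  let ?N = std_normal_distribution
  define C where "C = (LINT h|?N. h ^ (2 * k)) + 1"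
  have int: "integrable ?N (\<lambda>h. h ^ (2 * k))" by (rule std_normal_distribution_even_moments)
  have "measure ?N {h. z \<le> \<bar>h\<bar>} \<le> C / z ^ (2 * k)" if z: "z > 0" for z
  proof -
    have "measure ?N {h. z \<le> \<bar>h\<bar>} \<le> measure ?N {h \<in> space ?N. h ^ (2 * k) \<ge> z ^ (2 * k)}"
    proof (rule std_normal.finite_measure_mono)
      show "{h. z \<le> \<bar>h\<bar>} \<subseteq> {h \<in> space ?N. h ^ (2 * k) \<ge> z ^ (2 * k)}"
      proof
        fix h assume "h \<in> {h. z \<le> \<bar>h\<bar>}"
        then have "z ^ (2 * k) \<le> \<bar>h\<bar> ^ (2 * k)" using z by (intro power_mono) auto
        then show "h \<in> {h \<in> space ?N. h ^ (2 * k) \<ge> z ^ (2 * k)}" by (simp add: power_even_abs)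
      qed
    qed auto
    also have "\<dots> \<le> (LINT h|?N. h ^ (2 * k)) / z ^ (2 * k)"
      using z by (intro integral_Markov_inequality_measure[OF int, where A="{}"]) (auto simp: power_mult)
    also have "\<dots> \<le> C / z ^ (2 * k)" using z by (intro divide_right_mono) (auto simp: C_def)
    finally show ?thesis .
  qed
  moreover have "C > 0" unfolding C_def
    by (intro add_nonneg_pos Bochner_Integration.integral_nonneg) (auto simp: power_mult)
  ultimately show ?thesis by blast
qed

section \<open>The killed heat flow of an interval\<close>

text \<open>For \<open>b \<ge> 0\<close>, \<open>killed_heat b s y\<close> is the probability that a Brownian motion started at \<open>y \<ge> 0\<close> stays
  positive up to time \<open>s\<close> and then lies below \<open>b\<close>. By the reflection principle it is obtained from
  the free heat flow of the odd extension of the indicator of \<open>[0, b]\<close>, and this is the definition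
  used here; it makes sense for all real \<open>y\<close> and is odd in \<open>y\<close>.\<close>

definition killed_heat :: "real \<Rightarrow> real \<Rightarrow> real \<Rightarrow> real" where
  "killed_heat b s y = 2 * heat s y - heat s (y - b) - heat s (y + b)"

lemma killed_heat_measurable [measurable]: "killed_heat b s \<in> borel_measurable borel"
  unfolding killed_heat_def[abs_def] by measurable

lemma killed_heat_minus: "killed_heat b s (- y) = - killed_heat b s y"
proof -
  have "heat s (- y - b) = 1 - heat s (y + b)" "heat s (- y + b) = 1 - heat s (y - b)"
    using heat_minus[of s "y + b"] heat_minus[of s "y - b"] by simp_all
  then show ?thesis by (simp add: killed_heat_def heat_minus)
qed

lemma killed_heat_0 [simp]: "killed_heat 0 s y = 0"
  by (simp add: killed_heat_def)

text \<open>The kernel \<open>\<psi> s x\<close> is the transition density at time one of the killed Brownian motion.\<close>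

lemma psi_integral:
  assumes "t \<ge> 0"
  shows "(LBINT s:{0..t}. \<psi> s x) = killed_heat t 1 x"
proof -
  define F where "F s = \<Phi> (s - x) - \<Phi> (s + x)" for s
  have psi: "\<psi> s x = std_normal_density (s - x) - std_normal_density (s + x)" for s
    by (simp add: \<psi>_def std_normal_density_def algebra_simps)
  have F: "(F has_real_derivative \<psi> s x) (at s)" for s
    unfolding F_def[abs_def] psi by (auto intro!: derivative_eq_intros)
  have "(LBINT s:{0..t}. \<psi> s x) = F t - F 0"
    unfolding set_lebesgue_integral_def
  proof (rule integral_FTC_atLeastAtMost[OF assms])
    show "continuous_on {0..t} (\<lambda>s. \<psi> s x)" unfolding \<psi>_def by (intro continuous_intros) auto
  qed (use F in \<open>auto simp: has_real_derivative_iff_has_vector_derivative intro: has_vector_derivative_at_within\<close>)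
  also have "\<dots> = killed_heat t 1 x"
    using Phi_minus[of x] Phi_minus[of "x - t"]
    by (simp add: F_def killed_heat_def heat_def add.commute)
  finally show ?thesis .
qed

lemma killed_heat_nonneg:
  assumes s: "s > 0" and b: "b \<ge> 0" and y: "y \<ge> 0"
  shows "killed_heat b s y \<ge> 0"
proof -
  have "killed_heat 0 s y \<le> killed_heat b s y"
  proof (rule DERIV_nonneg_imp_nondecreasing[OF b])
    fix c assume c: "0 \<le> c" "c \<le> b"
    have "((\<lambda>c. killed_heat c s y) has_real_derivative heat1 s (y - c) - heat1 s (y + c)) (at c)"
      unfolding killed_heat_def
      by (auto intro!: derivative_eq_intros DERIV_chain2[OF heat_deriv(1)[OF s]])
    moreover have "(y - c)\<^sup>2 \<le> (y + c)\<^sup>2"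
      using c y by (simp add: power2_eq_square algebra_simps)
    then have "heat1 s (y + c) \<le> heat1 s (y - c)"
      using s unfolding heat1_def std_normal_density_def
      by (auto intro!: divide_right_mono mult_left_mono simp: power_divide)
    ultimately show "\<exists>d. ((\<lambda>c. killed_heat c s y) has_real_derivative d) (at c) \<and> 0 \<le> d"
      by (intro exI[of _ "heat1 s (y - c) - heat1 s (y + c)"]) simp
  qed
  then show ?thesis by simp
qed

lemma killed_heat_nonpos:
  assumes "s > 0" "b \<ge> 0" "y \<le> 0"
  shows "killed_heat b s y \<le> 0"
  using killed_heat_nonneg[of s b "- y"] assms by (simp add: killed_heat_minus)

lemma killed_heat_bound: "\<bar>killed_heat b s y\<bar> \<le> 2"
  using heat_nonneg[of s y] heat_le_1[of s y] heat_nonneg[of s "y - b"] heat_le_1[of s "y - b"]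
    heat_nonneg[of s "y + b"] heat_le_1[of s "y + b"] unfolding killed_heat_def by linarith

lemma killed_heat_le_1:
  assumes "s > 0" "b \<ge> 0"
  shows "killed_heat b s y \<le> 1"
proof -
  have "heat s y \<le> heat s (y + b)" using assms by (intro heat_mono) auto
  then show ?thesis using heat_nonneg[of s "y - b"] heat_le_1[of s y] unfolding killed_heat_def by linarith
qed

lemma killed_heat_ge_minus_1:
  assumes "s > 0" "b \<ge> 0"
  shows "killed_heat b s y \<ge> - 1"
  using killed_heat_le_1[OF assms, of "- y"] by (simp add: killed_heat_minus)

lemma killed_heat_lipschitz:
  assumes s: "s > 0"
  shows "\<bar>killed_heat b s y - killed_heat b' s y'\<bar> \<le> (4 * \<bar>y - y'\<bar> + 2 * \<bar>b - b'\<bar>) / sqrt s"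
proof -
  have 1: "\<bar>heat s y - heat s y'\<bar> \<le> \<bar>y - y'\<bar> / sqrt s" by (rule heat_lipschitz[OF s])
  have "\<bar>heat s (y - b) - heat s (y' - b')\<bar> \<le> \<bar>(y - b) - (y' - b')\<bar> / sqrt s" by (rule heat_lipschitz[OF s])
  also have "\<dots> \<le> (\<bar>y - y'\<bar> + \<bar>b - b'\<bar>) / sqrt s" using s by (intro divide_right_mono) auto
  finally have 2: "\<bar>heat s (y - b) - heat s (y' - b')\<bar> \<le> (\<bar>y - y'\<bar> + \<bar>b - b'\<bar>) / sqrt s" .
  have "\<bar>heat s (y + b) - heat s (y' + b')\<bar> \<le> \<bar>(y + b) - (y' + b')\<bar> / sqrt s" by (rule heat_lipschitz[OF s])
  also have "\<dots> \<le> (\<bar>y - y'\<bar> + \<bar>b - b'\<bar>) / sqrt s" using s by (intro divide_right_mono) auto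
  finally have 3: "\<bar>heat s (y + b) - heat s (y' + b')\<bar> \<le> (\<bar>y - y'\<bar> + \<bar>b - b'\<bar>) / sqrt s" .
  have "(4 * \<bar>y - y'\<bar> + 2 * \<bar>b - b'\<bar>) / sqrt s = 2 * (\<bar>y - y'\<bar> / sqrt s) + 2 * ((\<bar>y - y'\<bar> + \<bar>b - b'\<bar>) / sqrt s)"
    by (simp add: add_divide_distrib)
  then show ?thesis using 1 2 3 unfolding killed_heat_def by linarith
qed

lemma killed_heat_time_change:
  assumes s: "s > 0" and r: "r > 0"
  shows "\<bar>killed_heat b (s + r) y - killed_heat b s y\<bar> \<le> 4 * (sqrt r / sqrt s)"
  using heat_time_change[OF s r, of y] heat_time_change[OF s r, of "y - b"]
    heat_time_change[OF s r, of "y + b"] unfolding killed_heat_def by linarith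

text \<open>Smoothing the indicator of \<open>[0, b]\<close> for a short time \<open>m\<close> costs a Gaussian tail once the
  interval and the starting point are shifted by \<open>a\<close>.\<close>

lemma indicator_le_killed_heat:
  assumes m: "m > 0" and a: "a \<ge> 0" and b: "b \<ge> 0" and y: "y \<ge> 0"
  shows "indicator {..b} y \<le> killed_heat (b + 2 * a) m (y + a) + 3 * heat m (- a)"
proof (cases "y \<le> b")
  case True
  have "heat m a \<le> heat m (y + a)" using m y by (intro heat_mono) auto
  moreover have "heat m (y + a - (b + 2 * a)) \<le> heat m (- a)" using m True by (intro heat_mono) auto
  ultimately show ?thesis
    using True heat_le_1[of m "y + a + (b + 2 * a)"] heat_minus[of m a]
    unfolding killed_heat_def by simp
next
  case False
  then show ?thesis using killed_heat_nonneg[OF m, of "b + 2 * a" "y + a"] heat_nonneg[of m "- a"] a b y by simp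
qed

lemma killed_heat_le_indicator:
  assumes m: "m > 0" and a: "a \<ge> 0" and b: "b \<ge> 0"
  shows "killed_heat (max (b - a) 0) m y \<le> indicator {..b} y + heat m (- a)"
proof (cases "y \<le> b")
  case True
  then show ?thesis using killed_heat_le_1[OF m, of "max (b - a) 0" y] heat_nonneg[of m "- a"] by simp
next
  case False
  show ?thesis
  proof (cases "b \<le> a")
    case True
    then show ?thesis using heat_nonneg[of m "- a"] by (simp add: max_def split: split_indicator)
  next
    case ab: False
    have "heat m y \<le> heat m (y + (b - a))" using m ab by (intro heat_mono) auto
    moreover have "heat m a \<le> heat m (y - (b - a))" using m False by (intro heat_mono) auto
    ultimately have "killed_heat (b - a) m y \<le> heat m (- a)"
      using heat_le_1[of m y] heat_minus[of m a] unfolding killed_heat_def by simp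
    then show ?thesis using ab False by (simp add: max_def)
  qed
qed

section \<open>Replacing one summand by a normal variable\<close>

lemma (in prob_space) deriv_expectation_shift:
  fixes f f' :: "real \<Rightarrow> real"
  assumes deriv: "\<And>y. (f has_real_derivative f' y) (at y)"
    and meas [measurable]: "f \<in> borel_measurable borel" "f' \<in> borel_measurable borel"
    and rv [measurable]: "random_variable borel Z" "random_variable borel W"
    and W: "\<And>\<omega>. \<bar>W \<omega>\<bar> \<le> 1"
    and B: "\<And>y. \<bar>f y\<bar> \<le> B" and K: "\<And>y. \<bar>f' y\<bar> \<le> K"
  shows "((\<lambda>h. expectation (\<lambda>\<omega>. f (Z \<omega> + h) * W \<omega>)) has_real_derivative
    expectation (\<lambda>\<omega>. f' (Z \<omega> + h) * W \<omega>)) (at h)"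
proof -
  have lip: "\<bar>f u - f v\<bar> \<le> K * \<bar>u - v\<bar>" for u v
    using field_differentiable_bound[of UNIV f f' K u v] deriv K
    by (auto simp: has_field_derivative_at_within)
  have int: "integrable M (\<lambda>\<omega>. f (Z \<omega> + h) * W \<omega>)" for h
  proof (rule integrable_const_bound[of _ B])
    have "\<bar>f (Z \<omega> + h)\<bar> * \<bar>W \<omega>\<bar> \<le> B * 1" for \<omega>
      using B W order_trans[OF abs_ge_zero B] by (intro mult_mono) auto
    then show "AE \<omega> in M. norm (f (Z \<omega> + h) * W \<omega>) \<le> B" by (simp add: abs_mult)
  qed simp
  show ?thesis
    unfolding has_field_derivative_iff tendsto_at_iff_sequentially o_def
  proof (intro allI impI)
    fix Y :: "nat \<Rightarrow> real"
    assume Y: "\<forall>i. Y i \<in> UNIV - {h}" and lim: "Y \<longlonglongrightarrow> h"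
    have eq: "(expectation (\<lambda>\<omega>. f (Z \<omega> + Y i) * W \<omega>) - expectation (\<lambda>\<omega>. f (Z \<omega> + h) * W \<omega>)) / (Y i - h)
      = expectation (\<lambda>\<omega>. (f (Z \<omega> + Y i) - f (Z \<omega> + h)) / (Y i - h) * W \<omega>)" for i
      using int[of "Y i"] int[of h]
      by (simp add: Bochner_Integration.integral_diff[symmetric] left_diff_distrib del: Bochner_Integration.integral_diff)
    have "(\<lambda>i. expectation (\<lambda>\<omega>. (f (Z \<omega> + Y i) - f (Z \<omega> + h)) / (Y i - h) * W \<omega>))
      \<longlonglongrightarrow> expectation (\<lambda>\<omega>. f' (Z \<omega> + h) * W \<omega>)"
    proof (rule integral_dominated_convergence[where w="\<lambda>_. K"])
      show "AE \<omega> in M. (\<lambda>i. (f (Z \<omega> + Y i) - f (Z \<omega> + h)) / (Y i - h) * W \<omega>) \<longlonglongrightarrow> f' (Z \<omega> + h) * W \<omega>"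
      proof (rule AE_I2, intro tendsto_mult tendsto_const)
        fix \<omega>
        have "((\<lambda>y. (f (Z \<omega> + y) - f (Z \<omega> + h)) / (y - h)) \<longlongrightarrow> f' (Z \<omega> + h)) (at h)"
        proof -
          have "((\<lambda>y. f (Z \<omega> + y)) has_real_derivative f' (Z \<omega> + h) * 1) (at h)"
            by (rule DERIV_chain2[OF deriv]) (auto intro!: derivative_eq_intros)
          then show ?thesis by (simp add: has_field_derivative_iff)
        qed
        then show "(\<lambda>i. (f (Z \<omega> + Y i) - f (Z \<omega> + h)) / (Y i - h)) \<longlonglongrightarrow> f' (Z \<omega> + h)"
          unfolding tendsto_at_iff_sequentially o_def using Y lim by auto
      qed
      fix i
      show "AE \<omega> in M. norm ((f (Z \<omega> + Y i) - f (Z \<omega> + h)) / (Y i - h) * W \<omega>) \<le> K"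
      proof (rule AE_I2)
        fix \<omega>
        have "\<bar>(f (Z \<omega> + Y i) - f (Z \<omega> + h)) / (Y i - h)\<bar> \<le> K"
          using lip[of "Z \<omega> + Y i" "Z \<omega> + h"] Y by (simp add: abs_divide divide_le_eq)
        then have "\<bar>(f (Z \<omega> + Y i) - f (Z \<omega> + h)) / (Y i - h)\<bar> * \<bar>W \<omega>\<bar> \<le> K * 1"
          using W[of \<omega>] order_trans[OF abs_ge_zero K] by (intro mult_mono) auto
        then show "norm ((f (Z \<omega> + Y i) - f (Z \<omega> + h)) / (Y i - h) * W \<omega>) \<le> K" by (simp add: abs_mult)
      qed
    qed simp_all
    then show "(\<lambda>i. (expectation (\<lambda>\<omega>. f (Z \<omega> + Y i) * W \<omega>) - expectation (\<lambda>\<omega>. f (Z \<omega> + h) * W \<omega>)) / (Y i - h))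
      \<longlonglongrightarrow> expectation (\<lambda>\<omega>. f' (Z \<omega> + h) * W \<omega>)" unfolding eq .
  qed
qed

text \<open>The remainder of the second order Taylor expansion interpolates between the bounds given by
  the second and by the third derivative.\<close>

lemma taylor2_remainder_powr:
  fixes \<Gamma> \<Gamma>1 \<Gamma>2 \<Gamma>3 :: "real \<Rightarrow> real"
  assumes d: "\<And>y. (\<Gamma> has_real_derivative \<Gamma>1 y) (at y)" "\<And>y. (\<Gamma>1 has_real_derivative \<Gamma>2 y) (at y)"
      "\<And>y. (\<Gamma>2 has_real_derivative \<Gamma>3 y) (at y)"
    and bd: "\<And>y. \<bar>\<Gamma>2 y\<bar> \<le> A" "\<And>y. \<bar>\<Gamma>3 y\<bar> \<le> A / r"
    and r: "r > 0" and p: "0 \<le> p" "p \<le> 1"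
  shows "\<bar>\<Gamma> h - (\<Gamma> 0 + h * \<Gamma>1 0 + h\<^sup>2 / 2 * \<Gamma>2 0)\<bar> \<le> A / r powr p * \<bar>h\<bar> powr (2 + p)"
proof (cases "h = 0")
  case False
  have A: "A \<ge> 0" using order_trans[OF abs_ge_zero bd(1)] .
  define diff where "diff m = (case m of 0 \<Rightarrow> \<Gamma> | Suc 0 \<Rightarrow> \<Gamma>1 | _ \<Rightarrow> \<Gamma>2)" for m :: nat
  obtain t where t: "\<bar>t\<bar> \<le> \<bar>h\<bar>" "\<Gamma> h = (\<Sum>m<2. (diff m 0 / fact m) * h ^ m) + (diff 2 t / fact 2) * h ^ 2"
  proof -
    have "\<forall>m t. m < 2 \<and> \<bar>t\<bar> \<le> \<bar>h\<bar> \<longrightarrow> (diff m has_real_derivative diff (Suc m) t) (at t)"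
      using d by (auto simp: diff_def less_Suc_eq numeral_2_eq_2)
    from Maclaurin_bi_le[OF _ this, of \<Gamma>] show ?thesis using that by (auto simp: diff_def)
  qed
  then have eq: "\<Gamma> h - (\<Gamma> 0 + h * \<Gamma>1 0 + h\<^sup>2 / 2 * \<Gamma>2 0) = h\<^sup>2 / 2 * (\<Gamma>2 t - \<Gamma>2 0)"
    by (simp add: diff_def numeral_2_eq_2 field_simps)
  define w where "w = \<bar>h\<bar> / r"
  have w: "w > 0" using r False by (simp add: w_def)
  have "\<bar>\<Gamma>2 t - \<Gamma>2 0\<bar> \<le> A / r * \<bar>t\<bar>"
    using field_differentiable_bound[of UNIV \<Gamma>2 \<Gamma>3 "A / r" t 0] d bd
    by (auto simp: has_field_derivative_at_within)
  also have "\<dots> \<le> A / r * \<bar>h\<bar>" using t A r by (intro mult_left_mono) auto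
  finally have 1: "\<bar>\<Gamma>2 t - \<Gamma>2 0\<bar> \<le> A * w" by (simp add: w_def)
  have 2: "\<bar>\<Gamma>2 t - \<Gamma>2 0\<bar> \<le> 2 * A" using bd(1)[of t] bd(1)[of 0] by linarith
  have "\<bar>\<Gamma>2 t - \<Gamma>2 0\<bar> \<le> 2 * A * w powr p"
  proof (cases "w \<le> 1")
    case True
    then have "w powr 1 \<le> w powr p" using p w by (intro powr_mono') auto
    then have "A * w \<le> A * w powr p" using w A by (intro mult_left_mono) auto
    moreover have "A * w powr p \<ge> 0" using A by simp
    ultimately show ?thesis using 1 by linarith
  next
    case False
    then have "1 \<le> w powr p" using p by (intro ge_one_powr_ge_zero) auto
    then have "2 * A * 1 \<le> 2 * A * w powr p" using A by (intro mult_left_mono) auto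
    then show ?thesis using 2 by linarith
  qed
  then have "\<bar>h\<^sup>2 / 2 * (\<Gamma>2 t - \<Gamma>2 0)\<bar> \<le> h\<^sup>2 / 2 * (2 * A * w powr p)"
    unfolding abs_mult by (intro mult_mono) auto
  also have "\<dots> = A / r powr p * (\<bar>h\<bar> powr 2 * \<bar>h\<bar> powr p)"
    using r False by (simp add: w_def powr_divide)
  also have "\<dots> = A / r powr p * \<bar>h\<bar> powr (2 + p)" by (simp add: powr_add)
  finally show ?thesis unfolding eq .
qed simp

lemma expectation_taylor2:
  fixes \<mu> :: "real measure" and \<Gamma> :: "real \<Rightarrow> real"
  assumes "real_distribution \<mu>"
    and mom: "integrable \<mu> (\<lambda>h. h)" "integrable \<mu> (\<lambda>h. h\<^sup>2)" "(LINT h|\<mu>. h) = 0" "(LINT h|\<mu>. h\<^sup>2) = 1"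
      "integrable \<mu> (\<lambda>h. \<bar>h\<bar> powr (2 + p))"
    and \<Gamma>: "integrable \<mu> \<Gamma>"
    and bd: "\<And>h. \<bar>\<Gamma> h - (c0 + h * c1 + h\<^sup>2 / 2 * c2)\<bar> \<le> A * \<bar>h\<bar> powr (2 + p)"
  shows "\<bar>(LINT h|\<mu>. \<Gamma> h) - (c0 + c2 / 2)\<bar> \<le> A * (LINT h|\<mu>. \<bar>h\<bar> powr (2 + p))"
proof -
  interpret real_distribution \<mu> by fact
  have int: "integrable \<mu> (\<lambda>h. c0 + h * c1 + h\<^sup>2 / 2 * c2)" using mom by auto
  have "(LINT h|\<mu>. c0 + h * c1 + h\<^sup>2 / 2 * c2) = c0 + c2 / 2"
    using mom prob_space by simp
  then have "(LINT h|\<mu>. \<Gamma> h) - (c0 + c2 / 2) = (LINT h|\<mu>. \<Gamma> h - (c0 + h * c1 + h\<^sup>2 / 2 * c2))"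
    using \<Gamma> int by simp
  also have "\<bar>\<dots>\<bar> \<le> (LINT h|\<mu>. \<bar>\<Gamma> h - (c0 + h * c1 + h\<^sup>2 / 2 * c2)\<bar>)"
    by (rule integral_abs_bound)
  also have "\<dots> \<le> (LINT h|\<mu>. A * \<bar>h\<bar> powr (2 + p))"
    by (rule integral_mono) (use \<Gamma> int mom bd in auto)
  finally show ?thesis by simp
qed

lemma integrable_std_normal_abs_powr:
  assumes "0 \<le> p" "p \<le> 1"
  shows "integrable std_normal_distribution (\<lambda>h. \<bar>h\<bar> powr (2 + p))"
proof (rule Bochner_Integration.integrable_bound)
  show "integrable std_normal_distribution (\<lambda>h. 1 + h ^ 4)"
    using integrable_std_normal_distribution_moment[of 4] by auto
  show "AE h in std_normal_distribution. norm (\<bar>h\<bar> powr (2 + p)) \<le> norm (1 + h ^ 4)"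
  proof (rule AE_I2)
    fix h :: real
    have "\<bar>h\<bar> powr (2 + p) \<le> 1 + h ^ 4"
    proof (cases "\<bar>h\<bar> \<le> 1")
      case True
      then have "\<bar>h\<bar> powr (2 + p) \<le> 1" using assms by (intro powr_le1) auto
      then show ?thesis by (simp add: add_increasing2)
    next
      case False
      then have "\<bar>h\<bar> powr (2 + p) \<le> \<bar>h\<bar> powr 4" using assms by (intro powr_mono) auto
      also have "\<dots> = h ^ 4" using False by simp
      finally show ?thesis by simp
    qed
    then show "norm (\<bar>h\<bar> powr (2 + p)) \<le> norm (1 + h ^ 4)" by (simp add: add_nonneg_nonneg)
  qed
qed simp

text \<open>One step of the Lindeberg method for the heat flow, on an event whose indicator is \<open>W\<close>. The
  constant \<open>K\<close> measures how much mass the law of \<open>Z\<close> can put on an interval of length \<open>sqrt s\<close>; it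
  enters because only the averages of the second and third derivatives over the law of \<open>Z\<close> matter.
  Independence of \<open>(Z, W)\<close> and \<open>X\<close> is stated through their joint law.\<close>

lemma (in prob_space) heat_step:
  fixes X Z W :: "'a \<Rightarrow> real"
  assumes rv [measurable]: "random_variable borel X" "random_variable borel Z" "random_variable borel W"
    and ind: "distr M (borel \<Otimes>\<^sub>M borel) (\<lambda>\<omega>. (Z \<omega>, W \<omega>)) \<Otimes>\<^sub>M distr M borel X
      = distr M ((borel \<Otimes>\<^sub>M borel) \<Otimes>\<^sub>M borel) (\<lambda>\<omega>. ((Z \<omega>, W \<omega>), X \<omega>))"
    and W: "\<And>\<omega>. 0 \<le> W \<omega>" "\<And>\<omega>. W \<omega> \<le> 1"
    and mom: "integrable M X" "integrable M (\<lambda>\<omega>. (X \<omega>)\<^sup>2)" "expectation X = 0"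
      "expectation (\<lambda>\<omega>. (X \<omega>)\<^sup>2) = 1" "integrable M (\<lambda>\<omega>. \<bar>X \<omega>\<bar> powr (2 + p))"
    and p: "0 \<le> p" "p \<le> 1" and s: "s > 0"
    and K: "\<And>c. expectation (\<lambda>\<omega>. exp (- (Z \<omega> + c)\<^sup>2 / (4 * s))) \<le> K"
  shows "\<bar>expectation (\<lambda>\<omega>. heat s (Z \<omega> + X \<omega> + c) * W \<omega>) - expectation (\<lambda>\<omega>. heat (s + 1) (Z \<omega> + c) * W \<omega>)\<bar>
    \<le> 4 / s * K / sqrt s powr p * (expectation (\<lambda>\<omega>. \<bar>X \<omega>\<bar> powr (2 + p)) + (LINT h|std_normal_distribution. \<bar>h\<bar> powr (2 + p)))"
proof -
  let ?N = std_normal_distribution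
  define \<mu> where "\<mu> = distr M borel X"
  have ZW: "random_variable (borel \<Otimes>\<^sub>M borel) (\<lambda>\<omega>. (Z \<omega>, W \<omega>))" by measurable
  interpret \<mu>: real_distribution \<mu> unfolding \<mu>_def by simp
  have intW: "integrable M (\<lambda>\<omega>. f (Z \<omega> + h) * W \<omega>)" if "f \<in> borel_measurable borel" "\<And>y. \<bar>f y\<bar> \<le> B" for f h B
  proof (rule integrable_const_bound[of _ B])
    have "\<bar>f (Z \<omega> + h)\<bar> * \<bar>W \<omega>\<bar> \<le> B * 1" for \<omega>
      using that(2) W[of \<omega>] order_trans[OF abs_ge_zero that(2)] by (intro mult_mono) auto
    then show "AE \<omega> in M. norm (f (Z \<omega> + h) * W \<omega>) \<le> B" by (simp add: abs_mult)
  qed (use that in measurable)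
  \<comment> \<open>The averaged flow as a function of the step: integrating it over the law of \<open>X\<close> or over the
    standard normal law gives the two expectations to be compared.\<close>
  define \<Gamma> where "\<Gamma> h = expectation (\<lambda>\<omega>. heat s ((Z \<omega> + c) + h) * W \<omega>)" for h
  define \<Gamma>1 where "\<Gamma>1 h = expectation (\<lambda>\<omega>. heat1 s ((Z \<omega> + c) + h) * W \<omega>)" for h
  define \<Gamma>2 where "\<Gamma>2 h = expectation (\<lambda>\<omega>. heat2 s ((Z \<omega> + c) + h) * W \<omega>)" for h
  define \<Gamma>3 where "\<Gamma>3 h = expectation (\<lambda>\<omega>. heat3 s ((Z \<omega> + c) + h) * W \<omega>)" for h
  have aW: "\<bar>W \<omega>\<bar> \<le> 1" for \<omega> using W[of \<omega>] by simp
  have h2: "\<bar>heat2 s y\<bar> \<le> 4 / s" for y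
    by (rule order_trans[OF heat2_bound[OF s] mult_left_le]) (use s in auto)
  have h3: "\<bar>heat3 s y\<bar> \<le> 4 / (s * sqrt s)" for y
    by (rule order_trans[OF heat3_bound[OF s] mult_left_le]) (use s in auto)
  have h0: "\<bar>heat s y\<bar> \<le> 1" for y using heat_nonneg[of s y] heat_le_1[of s y] by simp
  have d: "(\<Gamma> has_real_derivative \<Gamma>1 y) (at y)" "(\<Gamma>1 has_real_derivative \<Gamma>2 y) (at y)"
    "(\<Gamma>2 has_real_derivative \<Gamma>3 y) (at y)" for y
    unfolding \<Gamma>_def[abs_def] \<Gamma>1_def[abs_def] \<Gamma>2_def[abs_def] \<Gamma>3_def[abs_def]
    by (rule deriv_expectation_shift[OF heat_deriv(1)[OF s] _ _ _ _ aW h0 heat1_bound[OF s]]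
        deriv_expectation_shift[OF heat_deriv(2)[OF s] _ _ _ _ aW heat1_bound[OF s] h2]
        deriv_expectation_shift[OF heat_deriv(3)[OF s] _ _ _ _ aW h2 h3]; measurable)+
  have exp_int: "integrable M (\<lambda>\<omega>. exp (- (Z \<omega> + h)\<^sup>2 / (4 * s)))" for h
    by (rule integrable_const_bound[of _ 1]) (use s in auto)
  have bound: "\<bar>expectation (\<lambda>\<omega>. f ((Z \<omega> + c) + y) * W \<omega>)\<bar> \<le> D * K"
    if f: "f \<in> borel_measurable borel" "\<And>y. \<bar>f y\<bar> \<le> D * exp (- y\<^sup>2 / (4 * s))" "D \<ge> 0" for f D y
  proof -
    have "\<bar>f y\<bar> \<le> D" for y
      by (rule order_trans[OF f(2) mult_left_le]) (use s f(3) in auto)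
    from intW[OF f(1) this, of "c + y"] have int: "integrable M (\<lambda>\<omega>. f ((Z \<omega> + c) + y) * W \<omega>)"
      by (simp add: add.assoc)
    have "\<bar>expectation (\<lambda>\<omega>. f ((Z \<omega> + c) + y) * W \<omega>)\<bar> \<le> expectation (\<lambda>\<omega>. \<bar>f ((Z \<omega> + c) + y) * W \<omega>\<bar>)"
      by (rule integral_abs_bound)
    also have "\<dots> \<le> expectation (\<lambda>\<omega>. D * exp (- (Z \<omega> + (c + y))\<^sup>2 / (4 * s)))"
    proof (rule integral_mono)
      fix \<omega>
      have "\<bar>f ((Z \<omega> + c) + y)\<bar> * \<bar>W \<omega>\<bar> \<le> D * exp (- (Z \<omega> + (c + y))\<^sup>2 / (4 * s)) * 1"
        using aW f(2)[of "(Z \<omega> + c) + y"] f(3) by (intro mult_mono) (auto simp: add.assoc)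
      then show "\<bar>f ((Z \<omega> + c) + y) * W \<omega>\<bar> \<le> D * exp (- (Z \<omega> + (c + y))\<^sup>2 / (4 * s))"
        by (simp add: abs_mult)
    qed (use int exp_int[of "c + y"] in auto)
    also have "\<dots> = D * expectation (\<lambda>\<omega>. exp (- (Z \<omega> + (c + y))\<^sup>2 / (4 * s)))" by simp
    also have "\<dots> \<le> D * K" using K f(3) by (intro mult_left_mono) auto
    finally show ?thesis .
  qed
  define A where "A = 4 / s * K"
  have b2: "\<bar>\<Gamma>2 y\<bar> \<le> A" for y
    unfolding \<Gamma>2_def A_def by (rule bound[OF _ heat2_bound[OF s]]) (use s in auto)
  have b3: "\<bar>\<Gamma>3 y\<bar> \<le> A / sqrt s" for y
  proof -
    have "\<bar>\<Gamma>3 y\<bar> \<le> 4 / (s * sqrt s) * K"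
      unfolding \<Gamma>3_def by (rule bound[OF _ heat3_bound[OF s]]) (use s in auto)
    then show ?thesis by (simp add: A_def)
  qed
  have taylor: "\<bar>\<Gamma> h - (\<Gamma> 0 + h * \<Gamma>1 0 + h\<^sup>2 / 2 * \<Gamma>2 0)\<bar> \<le> A / sqrt s powr p * \<bar>h\<bar> powr (2 + p)" for h
    using taylor2_remainder_powr[OF d b2 b3 _ p] s by simp
  have \<Gamma>_cont: "continuous_on UNIV \<Gamma>"
    using d(1) by (meson DERIV_isCont continuous_at_imp_continuous_on)
  then have \<Gamma>_meas [measurable]: "\<Gamma> \<in> borel_measurable borel" by (rule borel_measurable_continuous_onI)
  have \<Gamma>_bd: "\<bar>\<Gamma> h\<bar> \<le> 1" for h
  proof -
    have i: "integrable M (\<lambda>\<omega>. heat s ((Z \<omega> + c) + h) * W \<omega>)"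
      using intW[of "heat s" 1 "c + h"] h0 by (simp add: add.assoc)
    have "\<bar>\<Gamma> h\<bar> \<le> expectation (\<lambda>\<omega>. \<bar>heat s ((Z \<omega> + c) + h) * W \<omega>\<bar>)"
      unfolding \<Gamma>_def by (rule integral_abs_bound)
    also have "\<dots> \<le> expectation (\<lambda>\<omega>. 1)"
      using h0 aW by (intro integral_mono integrable_abs[OF i]) (auto simp: abs_mult intro!: mult_le_one)
    finally show ?thesis using prob_space by simp
  qed
  have e1: "\<bar>(LINT h|\<mu>. \<Gamma> h) - (\<Gamma> 0 + \<Gamma>2 0 / 2)\<bar> \<le> A / sqrt s powr p * (LINT h|\<mu>. \<bar>h\<bar> powr (2 + p))"
    by (rule expectation_taylor2[OF \<mu>.real_distribution_axioms _ _ _ _ _ _ taylor])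
       (use mom \<Gamma>_bd in \<open>auto simp: \<mu>_def integrable_distr_eq integral_distr intro!: integrable_const_bound[of _ 1]\<close>)
  have e2: "\<bar>(LINT h|?N. \<Gamma> h) - (\<Gamma> 0 + \<Gamma>2 0 / 2)\<bar> \<le> A / sqrt s powr p * (LINT h|?N. \<bar>h\<bar> powr (2 + p))"
    by (rule expectation_taylor2[OF real_dist_normal_dist _ _ _ _ _ _ taylor])
       (use integrable_std_normal_distribution_moment[of 1] integral_std_normal_distribution_moment_odd[of 1]
         std_normal_distribution_even_moments[of 1] integrable_std_normal_abs_powr[OF p]
         integrable_std_normal_bounded[OF \<Gamma>_meas \<Gamma>_bd] in simp_all)
  have f1: "(LINT h|\<mu>. \<Gamma> h) = expectation (\<lambda>\<omega>. heat s (Z \<omega> + X \<omega> + c) * W \<omega>)"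
  proof -
    let ?P = "distr M (borel \<Otimes>\<^sub>M borel) (\<lambda>\<omega>. (Z \<omega>, W \<omega>))"
    interpret P: prob_space ?P by (rule prob_space_distr) (rule ZW)
    interpret PP: pair_prob_space ?P \<mu> ..
    \<comment> \<open>\<open>W\<close> is clipped so that the integrand is bounded on the whole product space.\<close>
    define g where "g = (\<lambda>q. heat s (fst (fst q) + snd q + c) * max 0 (min 1 (snd (fst q))))"
    have g [measurable]: "g \<in> borel_measurable ((borel \<Otimes>\<^sub>M borel) \<Otimes>\<^sub>M borel)"
      unfolding g_def by measurable
    have gb: "\<bar>g q\<bar> \<le> 1" for q
      using h0 by (auto simp: g_def abs_mult intro!: mult_le_one)
    have sg: "sets (?P \<Otimes>\<^sub>M \<mu>) = sets ((borel \<Otimes>\<^sub>M borel) \<Otimes>\<^sub>M borel)"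
      by (intro sets_pair_measure_cong) auto
    have gm: "g \<in> borel_measurable (?P \<Otimes>\<^sub>M \<mu>)" using g sg measurable_cong_sets by blast
    have gi: "integrable (?P \<Otimes>\<^sub>M \<mu>) g"
      by (rule PP.integrable_const_bound[of _ 1]) (use gb gm in auto)
    have "expectation (\<lambda>\<omega>. heat s (Z \<omega> + X \<omega> + c) * W \<omega>) = expectation (\<lambda>\<omega>. g ((Z \<omega>, W \<omega>), X \<omega>))"
      using W by (simp add: g_def)
    also have "\<dots> = (LINT q|distr M ((borel \<Otimes>\<^sub>M borel) \<Otimes>\<^sub>M borel) (\<lambda>\<omega>. ((Z \<omega>, W \<omega>), X \<omega>)). g q)"
      by (rule integral_distr[symmetric]) measurable
    also have "\<dots> = (LINT q|(?P \<Otimes>\<^sub>M \<mu>). g q)"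
      using ind unfolding \<mu>_def by simp
    also have "\<dots> = (LINT h|\<mu>. (LINT q|?P. g (q, h)))"
      using PP.integral_snd[of "\<lambda>q h. g (q, h)"] gi by simp
    also have "\<dots> = (LINT h|\<mu>. \<Gamma> h)"
    proof (rule Bochner_Integration.integral_cong[OF refl])
      fix h
      have "(LINT q|?P. g (q, h)) = expectation (\<lambda>\<omega>. g ((Z \<omega>, W \<omega>), h))"
        by (rule integral_distr[OF ZW]) measurable
      also have "\<dots> = \<Gamma> h" using W by (simp add: g_def \<Gamma>_def ac_simps)
      finally show "(LINT q|?P. g (q, h)) = \<Gamma> h" .
    qed
    finally show ?thesis by simp
  qed
  have f2: "(LINT h|?N. \<Gamma> h) = expectation (\<lambda>\<omega>. heat (s + 1) (Z \<omega> + c) * W \<omega>)"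
  proof -
    interpret PN: pair_prob_space M ?N ..
    have "(LINT h|?N. \<Gamma> h) = expectation (\<lambda>\<omega>. (LINT h|?N. heat s ((Z \<omega> + c) + h) * W \<omega>))"
      unfolding \<Gamma>_def
    proof (rule PN.Fubini_integral)
      show "integrable (M \<Otimes>\<^sub>M ?N) (\<lambda>(\<omega>, h). heat s ((Z \<omega> + c) + h) * W \<omega>)"
        by (rule PN.integrable_const_bound[of _ 1])
           (use h0 aW in \<open>auto simp: abs_mult intro!: AE_I2 mult_le_one split: prod.split\<close>)
    qed
    also have "\<dots> = expectation (\<lambda>\<omega>. heat (s + 1) (Z \<omega> + c) * W \<omega>)"
      using heat_semigroup[OF s, of 1] by simp
    finally show ?thesis .
  qed
  have "\<bar>(LINT h|\<mu>. \<Gamma> h) - (LINT h|?N. \<Gamma> h)\<bar>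
    \<le> A / sqrt s powr p * (LINT h|\<mu>. \<bar>h\<bar> powr (2 + p)) + A / sqrt s powr p * (LINT h|?N. \<bar>h\<bar> powr (2 + p))"
    using e1 e2 by linarith
  also have "(LINT h|\<mu>. \<bar>h\<bar> powr (2 + p)) = expectation (\<lambda>\<omega>. \<bar>X \<omega>\<bar> powr (2 + p))"
    unfolding \<mu>_def by (rule integral_distr) measurable
  finally show ?thesis unfolding f1 f2 A_def by (simp only: distrib_left)
qed

section \<open>Normalised random walks and their concentration\<close>

lemma gaussian_integral_bound:
  assumes v: "v > 0"
  shows "(LINT z|std_normal_distribution. exp (- z\<^sup>2 / (2 * v\<^sup>2))) \<le> v"
proof -
  have "(LINT z|std_normal_distribution. exp (- z\<^sup>2 / (2 * v\<^sup>2))) = (LINT z|lborel. std_normal_density z * exp (- z\<^sup>2 / (2 * v\<^sup>2)))"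
    by (subst integral_density) auto
  also have "\<dots> \<le> (LINT z|lborel. v * normal_density 0 v z)"
  proof (rule integral_mono)
    have le: "std_normal_density z * exp (- z\<^sup>2 / (2 * v\<^sup>2)) \<le> v * normal_density 0 v z" for z
    proof -
      have "std_normal_density z \<le> 1 / sqrt (2 * pi)"
        unfolding std_normal_density_def by (simp add: divide_right_mono)
      then have "std_normal_density z * exp (- z\<^sup>2 / (2 * v\<^sup>2)) \<le> 1 / sqrt (2 * pi) * exp (- z\<^sup>2 / (2 * v\<^sup>2))"
        by (intro mult_right_mono) auto
      also have "\<dots> = v * normal_density 0 v z"
        using v by (simp add: normal_density_def real_sqrt_mult field_simps)
      finally show ?thesis .
    qed
    then show "std_normal_density z * exp (- z\<^sup>2 / (2 * v\<^sup>2)) \<le> v * normal_density 0 v z" for z .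
    show "integrable lborel (\<lambda>z. std_normal_density z * exp (- z\<^sup>2 / (2 * v\<^sup>2)))"
      by (rule Bochner_Integration.integrable_bound[of _ "\<lambda>z. v * normal_density 0 v z"])
         (use v le in auto)
  qed (use v in auto)
  also have "\<dots> = v" using v by simp
  finally show ?thesis .
qed

text \<open>A random walk with centred steps of variance one and finite absolute moment of order
  \<open>2 + p\<close>. Only \<open>p \<le> 1\<close> is used in the Lindeberg method, since a second order Taylor expansion
  cannot gain from moments higher than the third.\<close>

locale unit_walk = prob_space M for M :: "'a measure" +
  fixes X :: "nat \<Rightarrow> 'a \<Rightarrow> real" and p :: real
  assumes indep: "indep_vars (\<lambda>_. borel) X {1..}"
    and ident: "\<And>i. i \<ge> 1 \<Longrightarrow> distr M borel (X i) = distr M borel (X 1)"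
    and X_int: "integrable M (X 1)" and X_mean: "expectation (X 1) = 0"
    and X2_int: "integrable M (\<lambda>\<omega>. (X 1 \<omega>)\<^sup>2)" and X2_mean: "expectation (\<lambda>\<omega>. (X 1 \<omega>)\<^sup>2) = 1"
    and p: "0 < p" "p \<le> 1"
    and Xp_int: "integrable M (\<lambda>\<omega>. \<bar>X 1 \<omega>\<bar> powr (2 + p))"
begin

lemma X_rv: "i \<ge> 1 \<Longrightarrow> random_variable borel (X i)"
  using indep by (auto simp: indep_vars_def)

lemma X_Suc_rv [measurable]: "random_variable borel (X (Suc k))"
  by (rule X_rv) simp

lemma X_integrable:
  assumes [measurable]: "f \<in> borel_measurable borel" and "i \<ge> 1" "integrable M (\<lambda>\<omega>. f (X 1 \<omega>) :: real)"
  shows "integrable M (\<lambda>\<omega>. f (X i \<omega>))"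
  using assms integrable_distr_eq[OF X_rv[of i] assms(1)] integrable_distr_eq[OF X_rv[of 1] assms(1)] ident[of i]
  by simp

lemma X_expectation:
  assumes [measurable]: "f \<in> borel_measurable borel" and "i \<ge> 1"
  shows "expectation (\<lambda>\<omega>. f (X i \<omega>) :: real) = expectation (\<lambda>\<omega>. f (X 1 \<omega>))"
  using assms integral_distr[OF X_rv[of i] assms(1)] integral_distr[OF X_rv[of 1] assms(1)] ident[of i]
  by simp

lemma walk_rv [measurable]: "random_variable borel (walk X k)"
  unfolding walk_def[abs_def] by (intro borel_measurable_sum X_rv) auto

text \<open>The indicator of the event that the walk started at \<open>x\<close> is nonnegative at the times
  \<open>1, \<dots>, k\<close>, that is, of the event that the exit time exceeds \<open>k\<close>.\<close>

definition stay :: "real \<Rightarrow> nat \<Rightarrow> 'a \<Rightarrow> real" where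
  "stay x k \<omega> = (if \<forall>i\<in>{1..k}. 0 \<le> x + walk X i \<omega> then 1 else 0)"

lemma stay_rv [measurable]: "random_variable borel (stay x k)"
  unfolding stay_def[abs_def] by measurable

lemma stay_bounds: "0 \<le> stay x k \<omega>" "stay x k \<omega> \<le> 1"
  by (auto simp: stay_def)

lemma walk_0 [simp]: "walk X 0 \<omega> = 0" and stay_0 [simp]: "stay x 0 \<omega> = 1"
  by (auto simp: walk_def stay_def)

lemma walk_Suc: "walk X (Suc k) \<omega> = walk X k \<omega> + X (Suc k) \<omega>"
  by (simp add: walk_def)

lemma stay_Suc: "stay x (Suc k) \<omega> = (if 0 \<le> x + walk X (Suc k) \<omega> then stay x k \<omega> else 0)"
  by (auto simp: stay_def atLeastAtMostSuc_conv)

text \<open>The position and the survival indicator at time \<open>k\<close> are functions of the first \<open>k\<close> steps,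
  hence jointly independent of the next step.\<close>

lemma walk_stay_indep:
  "distr M (borel \<Otimes>\<^sub>M borel) (\<lambda>\<omega>. (walk X k \<omega>, stay x k \<omega>)) \<Otimes>\<^sub>M distr M borel (X (Suc k))
    = distr M ((borel \<Otimes>\<^sub>M borel) \<Otimes>\<^sub>M borel) (\<lambda>\<omega>. ((walk X k \<omega>, stay x k \<omega>), X (Suc k) \<omega>))"
proof -
  let ?P = "\<lambda>A. PiM A (\<lambda>_. borel) :: (nat \<Rightarrow> real) measure"
  let ?R = "\<lambda>A \<omega>. restrict (\<lambda>i. X i \<omega>) A"
  define f where "f v = ((\<Sum>i=1..k. v i), if \<forall>i\<in>{1..k}. 0 \<le> x + (\<Sum>j=1..i. v j) then 1 else 0 :: real)"
    for v :: "nat \<Rightarrow> real"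
  define g where "g v = v (Suc k)" for v :: "nat \<Rightarrow> real"
  have coord [measurable]: "(\<lambda>v. v i) \<in> borel_measurable (?P A)" if "i \<in> A" for i A
    using that by (rule measurable_component_singleton)
  have part: "(\<lambda>v. \<Sum>j=1..i. v j) \<in> borel_measurable (?P {1..k})" if "i \<le> k" for i
    using that by (intro borel_measurable_sum coord) auto
  have f: "f \<in> measurable (?P {1..k}) (borel \<Otimes>\<^sub>M borel)"
    unfolding f_def[abs_def]
  proof (intro measurable_Pair part order_refl measurable_If)
    have "{v \<in> space (?P {1..k}). 0 \<le> x + (\<Sum>j=1..i. v j)} \<in> sets (?P {1..k})" if "i \<in> {1..k}" for i
    proof -
      have [measurable]: "(\<lambda>v. \<Sum>j=1..i. v j) \<in> borel_measurable (?P {1..k})" using part that by simp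
      show ?thesis by measurable
    qed
    then show "{v \<in> space (?P {1..k}). \<forall>i\<in>{1..k}. 0 \<le> x + (\<Sum>j=1..i. v j)} \<in> sets (?P {1..k})"
      by (intro sets.sets_Collect_finite_All) auto
  qed auto
  have g: "g \<in> measurable (?P {Suc k}) borel" unfolding g_def[abs_def] by (rule coord) simp
  define P1 P2 where "P1 = ?P {1..k}" and "P2 = ?P {Suc k}"
  define R1 R2 where "R1 = ?R {1..k}" and "R2 = ?R {Suc k}"
  have "indep_var P1 R1 P2 R2"
    unfolding P1_def P2_def R1_def R2_def by (rule indep_var_restrict[OF indep]) auto
  then have rv: "random_variable P1 R1" "random_variable P2 R2"
    and eq: "distr M P1 R1 \<Otimes>\<^sub>M distr M P2 R2 = distr M (P1 \<Otimes>\<^sub>M P2) (\<lambda>\<omega>. (R1 \<omega>, R2 \<omega>))"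
    unfolding indep_var_distribution_eq by auto
  have f: "f \<in> measurable P1 (borel \<Otimes>\<^sub>M borel)" and g: "g \<in> measurable P2 borel"
    using f g by (simp_all add: P1_def P2_def)
  have fR: "f (R1 \<omega>) = (walk X k \<omega>, stay x k \<omega>)" for \<omega>
    by (auto simp: R1_def f_def walk_def stay_def intro!: sum.cong arg_cong2[where f="(\<le>)"])
  have gR: "g (R2 \<omega>) = X (Suc k) \<omega>" for \<omega> by (simp add: R2_def g_def)
  have d1: "distr M (borel \<Otimes>\<^sub>M borel) (\<lambda>\<omega>. (walk X k \<omega>, stay x k \<omega>)) = distr (distr M P1 R1) (borel \<Otimes>\<^sub>M borel) f"
    unfolding distr_distr[OF f rv(1)] o_def fR ..
  have d2: "distr M borel (\<lambda>\<omega>. X (Suc k) \<omega>) = distr (distr M P2 R2) borel g"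
    unfolding distr_distr[OF g rv(2)] o_def gR ..
  interpret D2: prob_space "distr M borel (\<lambda>\<omega>. X (Suc k) \<omega>)" by (rule prob_space_distr) measurable
  have sf: "sigma_finite_measure (distr (distr M P2 R2) borel g)"
    using D2.sigma_finite_measure_axioms unfolding d2 .
  have pair: "(\<lambda>(u, v). (f u, g v)) \<in> measurable (P1 \<Otimes>\<^sub>M P2) ((borel \<Otimes>\<^sub>M borel) \<Otimes>\<^sub>M borel)"
    using f g by measurable
  have "distr M (borel \<Otimes>\<^sub>M borel) (\<lambda>\<omega>. (walk X k \<omega>, stay x k \<omega>)) \<Otimes>\<^sub>M distr M borel (\<lambda>\<omega>. X (Suc k) \<omega>)
    = distr (distr M P1 R1 \<Otimes>\<^sub>M distr M P2 R2) ((borel \<Otimes>\<^sub>M borel) \<Otimes>\<^sub>M borel) (\<lambda>(u, v). (f u, g v))"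
    unfolding d1 d2 by (rule pair_measure_distr) (use f g sf in auto)
  also have "\<dots> = distr M ((borel \<Otimes>\<^sub>M borel) \<Otimes>\<^sub>M borel) (\<lambda>\<omega>. ((walk X k \<omega>, stay x k \<omega>), X (Suc k) \<omega>))"
    unfolding eq distr_distr[OF pair measurable_Pair[OF rv]] by (simp add: o_def fR gR)
  finally show ?thesis .
qed

text \<open>The common law of the steps.\<close>

definition \<mu> :: "real measure" where "\<mu> = distr M borel (X 1)"

text \<open>Near the origin the characteristic function of a step is \<open>1 - t\<^sup>2 / 2\<close> up to an error of order
  \<open>\<bar>t\<bar> powr (2 + p)\<close>.\<close>

lemma char_step_bound: "\<exists>t0>0. \<forall>t. \<bar>t\<bar> \<le> t0 \<longrightarrow> cmod (char \<mu> t) \<le> exp (- t\<^sup>2 / 4)"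
proof -
  define m where "m = expectation (\<lambda>\<omega>. \<bar>X 1 \<omega>\<bar> powr (2 + p))"
  have m: "m \<ge> 0" unfolding m_def by simp
  define t0 where "t0 = min 1 ((1 / (4 * (m + 1))) powr (1 / p))"
  have t0: "t0 > 0" "t0 \<le> 1" using m by (auto simp: t0_def)
  have "cmod (char \<mu> t) \<le> exp (- t\<^sup>2 / 4)" if t: "\<bar>t\<bar> \<le> t0" for t
  proof -
    have tp: "\<bar>t\<bar> powr p * m \<le> 1 / 4"
    proof -
      have "\<bar>t\<bar> powr p \<le> ((1 / (4 * (m + 1))) powr (1 / p)) powr p"
        using t p by (intro powr_mono2) (auto simp: t0_def)
      also have "\<dots> = 1 / (4 * (m + 1))" using p m by (simp add: powr_powr)
      finally have "\<bar>t\<bar> powr p * m \<le> 1 / (4 * (m + 1)) * m" using m by (intro mult_right_mono)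
      also have "\<dots> \<le> 1 / 4" using m by (simp add: field_simps)
      finally show ?thesis .
    qed
    have min_le: "min (6 * y\<^sup>2) (\<bar>t\<bar> * \<bar>y\<bar> ^ 3) \<le> 6 * \<bar>t\<bar> powr p * \<bar>y\<bar> powr (2 + p)" for y
    proof (cases "t = 0 \<or> y = 0")
      case False
      define w where "w = \<bar>t\<bar> * \<bar>y\<bar>"
      have w: "w > 0" using False by (simp add: w_def)
      have "6 * \<bar>t\<bar> powr p * \<bar>y\<bar> powr (2 + p) = 6 * y\<^sup>2 * w powr p"
        using False by (simp add: w_def powr_add powr_mult)
      moreover have "min (6 * y\<^sup>2) (\<bar>t\<bar> * \<bar>y\<bar> ^ 3) \<le> 6 * y\<^sup>2 * w powr p"
      proof (cases "w \<le> 1")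
        case True
        have "\<bar>t\<bar> * \<bar>y\<bar> ^ 3 = y\<^sup>2 * w powr 1" using w by (simp add: w_def power2_eq_square power3_eq_cube)
        also have "\<dots> \<le> y\<^sup>2 * w powr p" using w True p by (intro mult_left_mono powr_mono') auto
        also have "\<dots> \<le> 6 * y\<^sup>2 * w powr p" by simp
        finally show ?thesis by simp
      next
        case False
        then have "1 \<le> w powr p" using p by (intro ge_one_powr_ge_zero) auto
        then have "6 * y\<^sup>2 * 1 \<le> 6 * y\<^sup>2 * w powr p" by (intro mult_left_mono) auto
        then show ?thesis by simp
      qed
      ultimately show ?thesis by simp
    qed auto
    define u where "u = complex_of_real (1 - t\<^sup>2 / 2)"
    have "cmod (char \<mu> t - (1 - t^2 * 1 / 2)) \<le> (t^2 / 6) * expectation (\<lambda>\<omega>. min (6 * (X 1 \<omega>)^2) (\<bar>t\<bar> * \<bar>X 1 \<omega>\<bar>^3))"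
      by (rule char_approx3') (use X_int X_mean X2_int X2_mean X_rv[of 1] in \<open>auto simp: \<mu>_def\<close>)
    then have "cmod (char \<mu> t - u) \<le> (t^2 / 6) * expectation (\<lambda>\<omega>. min (6 * (X 1 \<omega>)^2) (\<bar>t\<bar> * \<bar>X 1 \<omega>\<bar>^3))"
      by (simp add: u_def)
    also have "\<dots> \<le> (t^2 / 6) * expectation (\<lambda>\<omega>. 6 * \<bar>t\<bar> powr p * \<bar>X 1 \<omega>\<bar> powr (2 + p))"
    proof (intro mult_left_mono integral_mono min_le)
      have [measurable]: "X 1 \<in> borel_measurable M" by (rule X_rv) simp
      show "integrable M (\<lambda>\<omega>. min (6 * (X 1 \<omega>)^2) (\<bar>t\<bar> * \<bar>X 1 \<omega>\<bar>^3))"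
        by (rule Bochner_Integration.integrable_bound[where f="\<lambda>\<omega>. 6 * (X 1 \<omega>)^2"]) (use X2_int in auto)
    qed (use Xp_int in auto)
    also have "\<dots> = t\<^sup>2 * (\<bar>t\<bar> powr p * m)" by (simp add: m_def)
    also have "\<dots> \<le> t\<^sup>2 * (1 / 4)" using tp by (intro mult_left_mono) auto
    finally have "cmod (char \<mu> t - u) \<le> t\<^sup>2 / 4" by simp
    moreover have "t\<^sup>2 \<le> 1" using t t0 by (simp add: abs_square_le_1)
    then have "cmod u = 1 - t\<^sup>2 / 2" unfolding u_def norm_of_real by simp
    moreover have "cmod (char \<mu> t) \<le> cmod (char \<mu> t - u) + cmod u"
      using norm_triangle_ineq[of "char \<mu> t - u" u] by simp
    ultimately have "cmod (char \<mu> t) \<le> 1 + (- t\<^sup>2 / 4)" by linarith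
    also have "\<dots> \<le> exp (- t\<^sup>2 / 4)" by (rule exp_ge_add_one_self)
    finally show ?thesis .
  qed
  then show ?thesis using t0 by blast
qed

lemma char_walk: "char (distr M borel (walk X k)) t = char \<mu> t ^ k"
proof -
  have "char (distr M borel (walk X k)) t = (\<Prod>i\<in>{1..k}. char (distr M borel (X i)) t)"
    unfolding walk_def[abs_def] by (rule char_distr_sum) (rule indep_vars_subset[OF indep], auto)
  also have "\<dots> = (\<Prod>i\<in>{1..k}. char \<mu> t)"
    unfolding \<mu>_def by (intro prod.cong refl arg_cong2[where f=char] ident) auto
  finally show ?thesis by simp
qed

text \<open>The Gaussian kernel is its own Fourier transform, so its expectation along the walk is an
  average of the characteristic function of the walk.\<close>

lemma walk_gaussian_expectation:
  assumes s: "s > 0" and k: "k \<ge> 1" and t0: "t0 > 0"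
    and char: "\<And>t. \<bar>t\<bar> \<le> t0 \<Longrightarrow> cmod (char \<mu> t) \<le> exp (- t\<^sup>2 / 4)"
  shows "expectation (\<lambda>\<omega>. exp (- (walk X k \<omega> + c)\<^sup>2 / (4 * s)))
    \<le> 2 * sqrt s / sqrt k + measure std_normal_distribution {z. sqrt (2 * s) * t0 \<le> \<bar>z\<bar>}"
proof -
  let ?N = std_normal_distribution
  interpret mu: real_distribution \<mu> unfolding \<mu>_def using X_rv[of 1] by simp
  interpret PN: pair_prob_space M ?N ..
  define l where "l = sqrt (2 * s)"
  have l: "l > 0" "l\<^sup>2 = 2 * s" using s by (auto simp: l_def)
  have ex: "complex_of_real (exp (- (walk X k \<omega> + c)\<^sup>2 / (4 * s))) = (CLINT z|?N. iexp ((walk X k \<omega> + c) / l * z))" for \<omega>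
  proof -
    have "(CLINT z|?N. iexp ((walk X k \<omega> + c) / l * z)) = char ?N ((walk X k \<omega> + c) / l)"
      by (simp add: char_def)
    also have "\<dots> = complex_of_real (exp (- ((walk X k \<omega> + c) / l)\<^sup>2 / 2))"
      by (simp add: char_std_normal_distribution)
    also have "- ((walk X k \<omega> + c) / l)\<^sup>2 / 2 = - (walk X k \<omega> + c)\<^sup>2 / (4 * s)"
      unfolding power_divide l(2) by simp
    finally show ?thesis by simp
  qed
  have inner: "(CLINT \<omega>|M. iexp ((walk X k \<omega> + c) / l * z)) = iexp (c / l * z) * char \<mu> (z / l) ^ k" for z
  proof -
    have "(CLINT \<omega>|M. iexp ((walk X k \<omega> + c) / l * z)) = (CLINT \<omega>|M. iexp (c / l * z) * iexp (z / l * walk X k \<omega>))"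
      by (intro Bochner_Integration.integral_cong) (auto simp: exp_add[symmetric] add_divide_distrib distrib_left distrib_right ac_simps)
    also have "\<dots> = iexp (c / l * z) * (CLINT \<omega>|M. iexp (z / l * walk X k \<omega>))"
      by (rule integral_mult_right_zero)
    also have "(CLINT \<omega>|M. iexp (z / l * walk X k \<omega>)) = char (distr M borel (walk X k)) (z / l)"
      unfolding char_def by (rule integral_distr[symmetric]) measurable
    finally show ?thesis by (simp add: char_walk)
  qed
  have "complex_of_real (expectation (\<lambda>\<omega>. exp (- (walk X k \<omega> + c)\<^sup>2 / (4 * s))))
    = (CLINT \<omega>|M. (CLINT z|?N. iexp ((walk X k \<omega> + c) / l * z)))"
    unfolding ex[symmetric] by simp
  also have "\<dots> = (CLINT z|?N. (CLINT \<omega>|M. iexp ((walk X k \<omega> + c) / l * z)))"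
  proof (rule PN.Fubini_integral[symmetric])
    show "integrable (M \<Otimes>\<^sub>M ?N) (\<lambda>(\<omega>, z). iexp ((walk X k \<omega> + c) / l * z))"
      by (rule PN.integrable_const_bound[of _ 1]) auto
  qed
  also have "\<dots> = (CLINT z|?N. iexp (c / l * z) * char \<mu> (z / l) ^ k)" unfolding inner ..
  finally have eq: "complex_of_real (expectation (\<lambda>\<omega>. exp (- (walk X k \<omega> + c)\<^sup>2 / (4 * s)))) = \<dots>" .
  have "expectation (\<lambda>\<omega>. exp (- (walk X k \<omega> + c)\<^sup>2 / (4 * s)))
    \<le> cmod (complex_of_real (expectation (\<lambda>\<omega>. exp (- (walk X k \<omega> + c)\<^sup>2 / (4 * s)))))" by simp
  also have "\<dots> \<le> (LINT z|?N. cmod (iexp (c / l * z) * char \<mu> (z / l) ^ k))"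
    unfolding eq by (rule integral_norm_bound)
  also have "\<dots> \<le> (LINT z|?N. exp (- z\<^sup>2 / (2 * (2 * sqrt s / sqrt k)\<^sup>2)) + indicator {z. l * t0 \<le> \<bar>z\<bar>} z)"
  proof (rule integral_mono)
    have le1: "cmod (char \<mu> (z / l) ^ k) \<le> 1" for z
      by (simp add: norm_power power_le_one mu.cmod_char_le_1)
    show "integrable ?N (\<lambda>z. cmod (iexp (c / l * z) * char \<mu> (z / l) ^ k))"
      by (rule std_normal.integrable_const_bound[of _ 1]) (use le1 in \<open>auto simp: norm_mult\<close>)
    show "integrable ?N (\<lambda>z. exp (- z\<^sup>2 / (2 * (2 * sqrt s / sqrt k)\<^sup>2)) + indicator {z. l * t0 \<le> \<bar>z\<bar>} z)"
      by (intro Bochner_Integration.integrable_add std_normal.integrable_const_bound[of _ 1]) auto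
    fix z :: real
    show "cmod (iexp (c / l * z) * char \<mu> (z / l) ^ k)
      \<le> exp (- z\<^sup>2 / (2 * (2 * sqrt s / sqrt k)\<^sup>2)) + indicator {z. l * t0 \<le> \<bar>z\<bar>} z"
    proof (cases "l * t0 \<le> \<bar>z\<bar>")
      case True
      then show ?thesis using le1[of z] by (simp add: norm_mult add_increasing)
    next
      case False
      then have "\<bar>z / l\<bar> \<le> t0" using l by (simp add: field_simps)
      from char[OF this] have "cmod (char \<mu> (z / l)) ^ k \<le> exp (- (z / l)\<^sup>2 / 4) ^ k"
        by (intro power_mono) auto
      also have "\<dots> = exp (real k * (- (z / l)\<^sup>2 / 4))" by (rule exp_of_nat_mult[symmetric])
      also have "real k * (- (z / l)\<^sup>2 / 4) = - z\<^sup>2 / (2 * (2 * sqrt s / sqrt k)\<^sup>2)"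
        unfolding power_divide l(2) using s k by (simp add: power_mult_distrib field_simps)
      finally show ?thesis using False by (simp add: norm_mult norm_power)
    qed
  qed
  also have "\<dots> = (LINT z|?N. exp (- z\<^sup>2 / (2 * (2 * sqrt s / sqrt k)\<^sup>2))) + measure ?N {z. l * t0 \<le> \<bar>z\<bar>}"
    by (subst Bochner_Integration.integral_add) (auto intro!: std_normal.integrable_const_bound[of _ 1])
  also have "\<dots> \<le> 2 * sqrt s / sqrt k + measure ?N {z. l * t0 \<le> \<bar>z\<bar>}"
    using s k by (intro add_right_mono gaussian_integral_bound) auto
  finally show ?thesis unfolding l_def .
qed

text \<open>At time \<open>k < n\<close> the walk puts mass of order \<open>sqrt (s / n)\<close> on an interval of length \<open>sqrt s\<close>, up
  to an error that decays like a prescribed power of \<open>s\<close>. The hypothesis \<open>n \<le> k + s\<close> makes the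
  claim uniform in \<open>k\<close>: if \<open>k < n / 2\<close>, then \<open>s > n / 2\<close> and the bound is trivial.\<close>

lemma walk_concentration:
  "\<exists>C>0. \<forall>n k s c. k < n \<longrightarrow> 0 < s \<longrightarrow> real n \<le> real k + s \<longrightarrow>
    expectation (\<lambda>\<omega>. exp (- (walk X k \<omega> + c)\<^sup>2 / (4 * s))) \<le> C * (sqrt s / sqrt n + 1 / s ^ q)"
proof -
  obtain t0 where t0: "t0 > 0" and char: "\<And>t. \<bar>t\<bar> \<le> t0 \<Longrightarrow> cmod (char \<mu> t) \<le> exp (- t\<^sup>2 / 4)"
    using char_step_bound by blast
  obtain D where D: "D > 0" and tail: "\<And>z. z > 0 \<Longrightarrow> measure std_normal_distribution {h. z \<le> \<bar>h\<bar>} \<le> D / z ^ (2 * q)"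
    using std_normal_tail by blast
  define C where "C = 4 + D / (2 * t0\<^sup>2) ^ q"
  have C: "C > 0" using D t0 by (simp add: C_def add_pos_nonneg)
  have "expectation (\<lambda>\<omega>. exp (- (walk X k \<omega> + c)\<^sup>2 / (4 * s))) \<le> C * (sqrt s / sqrt n + 1 / s ^ q)"
    if kn: "k < n" and s: "0 < s" and ns: "real n \<le> real k + s" for n k s c
  proof (cases "2 * k < n")
    case True
    have "expectation (\<lambda>\<omega>. exp (- (walk X k \<omega> + c)\<^sup>2 / (4 * s))) \<le> expectation (\<lambda>\<omega>. 1)"
      using s by (intro integral_mono integrable_const_bound[of _ 1]) auto
    then have "expectation (\<lambda>\<omega>. exp (- (walk X k \<omega> + c)\<^sup>2 / (4 * s))) \<le> 1" using prob_space by simp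
    also have "1 \<le> 2 * (sqrt s / sqrt n)"
    proof -
      have "sqrt (real n) \<le> sqrt (4 * s)" using True ns by (intro real_sqrt_le_mono) linarith
      then show ?thesis using kn by (simp add: real_sqrt_mult field_simps)
    qed
    also have "\<dots> \<le> C * (sqrt s / sqrt n)"
      using D t0 s by (intro mult_right_mono) (auto simp: C_def)
    also have "\<dots> \<le> C * (sqrt s / sqrt n + 1 / s ^ q)" using C s by (intro mult_left_mono) auto
    finally show ?thesis .
  next
    case False
    then have k: "k \<ge> 1" using kn by linarith
    have "expectation (\<lambda>\<omega>. exp (- (walk X k \<omega> + c)\<^sup>2 / (4 * s)))
      \<le> 2 * sqrt s / sqrt k + measure std_normal_distribution {z. sqrt (2 * s) * t0 \<le> \<bar>z\<bar>}"
      by (rule walk_gaussian_expectation[OF s k t0 char])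
    also have "measure std_normal_distribution {z. sqrt (2 * s) * t0 \<le> \<bar>z\<bar>} \<le> D / (sqrt (2 * s) * t0) ^ (2 * q)"
      using s t0 by (intro tail) auto
    also have "(sqrt (2 * s) * t0) ^ (2 * q) = (2 * t0\<^sup>2) ^ q * s ^ q"
      using s by (simp add: power_mult power_mult_distrib)
    also have "2 * sqrt s / sqrt k \<le> 4 * (sqrt s / sqrt n)"
    proof -
      have "sqrt (real n) \<le> sqrt (4 * real k)" using False by (intro real_sqrt_le_mono) linarith
      then have "sqrt (real n) \<le> 2 * sqrt (real k)" by (simp add: real_sqrt_mult)
      from mult_left_mono[OF this, of "2 * sqrt s"] show ?thesis using s k kn by (simp add: field_simps)
    qed
    finally have "expectation (\<lambda>\<omega>. exp (- (walk X k \<omega> + c)\<^sup>2 / (4 * s)))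
      \<le> 4 * (sqrt s / sqrt n) + D / (2 * t0\<^sup>2) ^ q * (1 / s ^ q)" by simp
    also have "\<dots> \<le> C * (sqrt s / sqrt n) + C * (1 / s ^ q)"
      using D t0 s by (intro add_mono mult_right_mono) (auto simp: C_def)
    finally show ?thesis by (simp only: distrib_left)
  qed
  then show ?thesis using C by blast
qed

section \<open>The Lindeberg method with absorption\<close>

text \<open>The moments that control replacing a step by a standard normal variable.\<close>

definition moments :: real where
  "moments = expectation (\<lambda>\<omega>. \<bar>X 1 \<omega>\<bar> powr (2 + p)) + (LINT h|std_normal_distribution. \<bar>h\<bar> powr (2 + p))"

lemma moments_nonneg: "moments \<ge> 0"
  unfolding moments_def by (intro add_nonneg_nonneg Bochner_Integration.integral_nonneg) auto

lemma integrable_bounded_stay: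
  assumes "f \<in> borel_measurable borel" "\<And>y. \<bar>f y\<bar> \<le> B"
  shows "integrable M (\<lambda>\<omega>. f (walk X k \<omega> + c) * stay x j \<omega>)"
proof (rule integrable_const_bound[of _ B])
  have "\<bar>f (walk X k \<omega> + c)\<bar> * \<bar>stay x j \<omega>\<bar> \<le> B * 1" for \<omega>
    using assms(2) stay_bounds[of x j \<omega>] order_trans[OF abs_ge_zero assms(2)] by (intro mult_mono) auto
  then show "AE \<omega> in M. norm (f (walk X k \<omega> + c) * stay x j \<omega>) \<le> B" by (simp add: abs_mult)
qed (use assms in measurable)

lemma integrable_killed_heat:
  "integrable M (\<lambda>\<omega>. killed_heat b s (walk X k \<omega> + c) * stay x j \<omega>)"
  by (rule integrable_bounded_stay[OF killed_heat_measurable killed_heat_bound])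

lemma killed_heat_step:
  assumes s: "s > 0"
    and K: "\<And>c. expectation (\<lambda>\<omega>. exp (- (walk X k \<omega> + c)\<^sup>2 / (4 * s))) \<le> K"
  shows "\<bar>expectation (\<lambda>\<omega>. killed_heat b s (walk X (Suc k) \<omega> + c) * stay x k \<omega>)
    - expectation (\<lambda>\<omega>. killed_heat b (s + 1) (walk X k \<omega> + c) * stay x k \<omega>)\<bar>
    \<le> 16 / s * K / sqrt s powr p * moments"
proof -
  let ?f = "\<lambda>c. expectation (\<lambda>\<omega>. heat s (walk X (Suc k) \<omega> + c) * stay x k \<omega>)"
  let ?g = "\<lambda>c. expectation (\<lambda>\<omega>. heat (s + 1) (walk X k \<omega> + c) * stay x k \<omega>)"
  have step: "\<bar>?f c - ?g c\<bar> \<le> 4 / s * K / sqrt s powr p * moments" for c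
  proof -
    have mom: "integrable M (X (Suc k))" "integrable M (\<lambda>\<omega>. (X (Suc k) \<omega>)\<^sup>2)"
      "integrable M (\<lambda>\<omega>. \<bar>X (Suc k) \<omega>\<bar> powr (2 + p))"
      "expectation (X (Suc k)) = 0" "expectation (\<lambda>\<omega>. (X (Suc k) \<omega>)\<^sup>2) = 1"
      "expectation (\<lambda>\<omega>. \<bar>X (Suc k) \<omega>\<bar> powr (2 + p)) = expectation (\<lambda>\<omega>. \<bar>X 1 \<omega>\<bar> powr (2 + p))"
      using X_integrable[of "\<lambda>y. y" "Suc k"] X_integrable[of "\<lambda>y. y\<^sup>2" "Suc k"]
        X_integrable[of "\<lambda>y. \<bar>y\<bar> powr (2 + p)" "Suc k"] X_expectation[of "\<lambda>y. y" "Suc k"]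
        X_expectation[of "\<lambda>y. y\<^sup>2" "Suc k"] X_expectation[of "\<lambda>y. \<bar>y\<bar> powr (2 + p)" "Suc k"]
        X_int X2_int Xp_int X_mean X2_mean by simp_all
    have "\<bar>expectation (\<lambda>\<omega>. heat s (walk X k \<omega> + X (Suc k) \<omega> + c) * stay x k \<omega>) - ?g c\<bar>
      \<le> 4 / s * K / sqrt s powr p * (expectation (\<lambda>\<omega>. \<bar>X (Suc k) \<omega>\<bar> powr (2 + p)) + (LINT h|std_normal_distribution. \<bar>h\<bar> powr (2 + p)))"
      by (rule heat_step[OF X_Suc_rv walk_rv stay_rv walk_stay_indep stay_bounds mom(1,2,4,5,3) _ _ s K]) (use p in auto)
    then show ?thesis unfolding mom(6) walk_Suc moments_def .
  qed
  have int: "integrable M (\<lambda>\<omega>. heat r (walk X j \<omega> + c) * stay x k \<omega>)" for r j c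
    by (rule integrable_bounded_stay[of _ 1]) (auto simp: heat_nonneg heat_le_1)
  have lin: "expectation (\<lambda>\<omega>. killed_heat b r (walk X j \<omega> + c) * stay x k \<omega>)
    = 2 * expectation (\<lambda>\<omega>. heat r (walk X j \<omega> + c) * stay x k \<omega>)
      - expectation (\<lambda>\<omega>. heat r (walk X j \<omega> + (c - b)) * stay x k \<omega>)
      - expectation (\<lambda>\<omega>. heat r (walk X j \<omega> + (c + b)) * stay x k \<omega>)" for r j
  proof -
    have "expectation (\<lambda>\<omega>. killed_heat b r (walk X j \<omega> + c) * stay x k \<omega>)
      = expectation (\<lambda>\<omega>. 2 * (heat r (walk X j \<omega> + c) * stay x k \<omega>)
          - heat r (walk X j \<omega> + (c - b)) * stay x k \<omega> - heat r (walk X j \<omega> + (c + b)) * stay x k \<omega>)"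
      by (intro Bochner_Integration.integral_cong) (auto simp: killed_heat_def algebra_simps)
    then show ?thesis using int by simp
  qed
  have "16 / s * K / sqrt s powr p * moments = 4 * (4 / s * K / sqrt s powr p * moments)" by simp
  then show ?thesis unfolding lin using step[of c] step[of "c - b"] step[of "c + b"] by linarith
qed

text \<open>The expectation of the time-reversed heat flow along the walk while the walk stays nonnegative:
  at time \<open>k\<close> of \<open>n\<close> the flow has the remaining time \<open>n - k\<close> to run, plus a smoothing time \<open>m\<close>. The walk
  starts at \<open>x\<close>, but the flow is evaluated with the starting point \<open>c\<close>.\<close>

definition flow :: "nat \<Rightarrow> real \<Rightarrow> real \<Rightarrow> real \<Rightarrow> real \<Rightarrow> nat \<Rightarrow> real" where
  "flow n m b c x k = expectation (\<lambda>\<omega>. killed_heat b (m + real (n - k)) (walk X k \<omega> + c) * stay x k \<omega>)"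

text \<open>The cost of replacing step \<open>k + 1\<close>, given a bound \<open>K k\<close> for the concentration of the walk at time
  \<open>k\<close>.\<close>

definition lindeberg_error :: "nat \<Rightarrow> real \<Rightarrow> (nat \<Rightarrow> real) \<Rightarrow> nat \<Rightarrow> real" where
  "lindeberg_error n m K k = 16 / (m + real (n - Suc k)) * K k / sqrt (m + real (n - Suc k)) powr p * moments"

lemma flow_step:
  assumes m: "m > 0" and k: "k < n"
    and K: "\<And>c. expectation (\<lambda>\<omega>. exp (- (walk X k \<omega> + c)\<^sup>2 / (4 * (m + real (n - Suc k))))) \<le> K k"
  shows "\<bar>expectation (\<lambda>\<omega>. killed_heat b (m + real (n - Suc k)) (walk X (Suc k) \<omega> + c) * stay x k \<omega>)
    - flow n m b c x k\<bar> \<le> lindeberg_error n m K k"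
proof -
  have "m + real (n - k) = m + real (n - Suc k) + 1" using k by (simp add: of_nat_diff)
  then show ?thesis unfolding flow_def lindeberg_error_def
    using killed_heat_step[OF _ K, of b c x] m by simp
qed

text \<open>When the walk leaves the half-line, the odd flow is nonpositive, so absorption can only increase
  its expectation.\<close>

lemma flow_lower:
  assumes m: "m > 0" and b: "b \<ge> 0"
    and K: "\<And>k c. k < n \<Longrightarrow> expectation (\<lambda>\<omega>. exp (- (walk X k \<omega> + c)\<^sup>2 / (4 * (m + real (n - Suc k))))) \<le> K k"
    and "k \<le> n"
  shows "flow n m b x x k \<ge> flow n m b x x 0 - (\<Sum>i<k. lindeberg_error n m K i)"
  using \<open>k \<le> n\<close>
proof (induction k)
  case (Suc k)
  let ?s = "m + real (n - Suc k)"
  have s: "?s > 0" using m by simp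
  have "expectation (\<lambda>\<omega>. killed_heat b ?s (walk X (Suc k) \<omega> + x) * stay x k \<omega>) \<le> flow n m b x x (Suc k)"
    unfolding flow_def
  proof (intro integral_mono integrable_killed_heat)
    fix \<omega>
    have "killed_heat b ?s (walk X (Suc k) \<omega> + x) \<le> 0" if "\<not> 0 \<le> x + walk X (Suc k) \<omega>"
      by (rule killed_heat_nonpos[OF s b]) (use that in simp)
    then show "killed_heat b ?s (walk X (Suc k) \<omega> + x) * stay x k \<omega> \<le> killed_heat b ?s (walk X (Suc k) \<omega> + x) * stay x (Suc k) \<omega>"
      using stay_bounds[of x k \<omega>] by (auto simp: stay_Suc mult_nonpos_nonneg)
  qed
  then show ?case using flow_step[of m k n K b x x] Suc K m by simp
qed simp

text \<open>For the converse bound the starting point is raised by \<open>a\<close>: then the flow at the exit time is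
  nonnegative unless the last step of the walk is longer than \<open>a\<close>.\<close>

lemma flow_upper:
  assumes m: "m > 0" and b: "b \<ge> 0" and x: "x \<ge> 0"
    and K: "\<And>k c. k < n \<Longrightarrow> expectation (\<lambda>\<omega>. exp (- (walk X k \<omega> + c)\<^sup>2 / (4 * (m + real (n - Suc k))))) \<le> K k"
    and "k \<le> n"
  shows "flow n m b (x + a) x k \<le> flow n m b (x + a) x 0 + (\<Sum>i<k. lindeberg_error n m K i)
    + real k * expectation (\<lambda>\<omega>. indicator {y. a < \<bar>y\<bar>} (X 1 \<omega>))"
  using \<open>k \<le> n\<close>
proof (induction k)
  case (Suc k)
  let ?s = "m + real (n - Suc k)"
  let ?J = "{y. a < \<bar>y\<bar>} :: real set"
  have s: "?s > 0" using m by simp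
  have J: "integrable M (\<lambda>\<omega>. indicator ?J (X (Suc k) \<omega>) :: real)"
    by (rule integrable_const_bound[of _ 1]) auto
  have i: "integrable M (\<lambda>\<omega>. killed_heat b ?s (walk X (Suc k) \<omega> + (x + a)) * stay x j \<omega>)" for j
    by (rule integrable_killed_heat)
  have "flow n m b (x + a) x (Suc k)
    \<le> expectation (\<lambda>\<omega>. killed_heat b ?s (walk X (Suc k) \<omega> + (x + a)) * stay x k \<omega> + indicator ?J (X (Suc k) \<omega>))"
    unfolding flow_def
  proof (intro integral_mono i Bochner_Integration.integrable_add J)
    fix \<omega>
    let ?Y = "killed_heat b ?s (walk X (Suc k) \<omega> + (x + a))"
    show "?Y * stay x (Suc k) \<omega> \<le> ?Y * stay x k \<omega> + indicator ?J (X (Suc k) \<omega>)"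
    proof (cases "stay x (Suc k) \<omega> = stay x k \<omega>")
      case False
      then have 0: "stay x (Suc k) \<omega> = 0" "stay x k \<omega> = 1"
        by (auto simp: stay_Suc stay_def split: if_splits)
      have pos: "0 \<le> x + walk X k \<omega>"
        using 0(2) x by (cases k) (auto simp: stay_Suc split: if_splits)
      show ?thesis
      proof (cases "a < \<bar>X (Suc k) \<omega>\<bar>")
        case True
        then show ?thesis using killed_heat_ge_minus_1[OF s b, of "walk X (Suc k) \<omega> + (x + a)"] 0 by simp
      next
        case False
        then have "0 \<le> walk X (Suc k) \<omega> + (x + a)" using pos by (simp add: walk_Suc)
        then show ?thesis using killed_heat_nonneg[OF s b] 0 False by simp
      qed
    qed simp
  qed
  also have "\<dots> = expectation (\<lambda>\<omega>. killed_heat b ?s (walk X (Suc k) \<omega> + (x + a)) * stay x k \<omega>)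
      + expectation (\<lambda>\<omega>. indicator ?J (X (Suc k) \<omega>))"
    using i J by simp
  also have "expectation (\<lambda>\<omega>. indicator ?J (X (Suc k) \<omega>)) = expectation (\<lambda>\<omega>. indicator ?J (X 1 \<omega>) :: real)"
    by (rule X_expectation) auto
  finally show ?case
    using flow_step[of m k n K b "x + a" x] Suc K m by (simp add: distrib_right)
qed simp

text \<open>With \<open>s = m + j\<close>, where \<open>j = n - k - 1\<close>, the main part of the error is, up to a
  constant, at most \<open>(j + 1) powr - ((1 + p) / 2) / sqrt n\<close>; splitting off \<open>(j + 1) powr (1 / 2 - \<epsilon>) \<le> n powr (1 / 2 - \<epsilon>)\<close>
  leaves a convergent series because \<open>\<epsilon> < p / 2\<close>.\<close>

lemma lindeberg_error_sum:
  assumes \<epsilon>: "0 < \<epsilon>" "\<epsilon> < p / 2" and q: "\<kappa> > 0" "\<kappa> * real q \<ge> 2" and C: "C \<ge> 0"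
  shows "\<exists>D>0. \<forall>n m. n \<ge> 1 \<longrightarrow> m \<ge> real n powr \<kappa> \<longrightarrow>
    (\<Sum>k<n. lindeberg_error n m (\<lambda>k. C * (sqrt (m + real (n - Suc k)) / sqrt n + 1 / (m + real (n - Suc k)) ^ q)) k)
    \<le> D * real n powr - \<epsilon>"
proof -
  define f where "f j = real (Suc j) powr - (1 + p / 2 - \<epsilon>)" for j
  have sf: "summable f"
    unfolding f_def using summable_Suc_iff[of "\<lambda>j. real j powr - (1 + p / 2 - \<epsilon>)"] \<epsilon>
    by (simp add: summable_real_powr_iff)
  define Z where "Z = suminf f"
  have Z: "Z \<ge> 0" unfolding Z_def by (rule suminf_nonneg[OF sf]) (simp add: f_def)
  define D where "D = 16 * C * moments * (Z + 1) + 1"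
  have D: "D > 0" using C Z moments_nonneg by (simp add: D_def add_nonneg_pos)
  have "(\<Sum>k<n. lindeberg_error n m (\<lambda>k. C * (sqrt (m + real (n - Suc k)) / sqrt n + 1 / (m + real (n - Suc k)) ^ q)) k)
    \<le> D * real n powr - \<epsilon>" if n: "n \<ge> 1" and m: "m \<ge> real n powr \<kappa>" for n m
  proof -
    have m1: "m \<ge> 1" using ge_one_powr_ge_zero[of "real n" \<kappa>] n m q by simp
    have mq: "m ^ q \<ge> real n * real n"
    proof -
      have "real n * real n = real n powr 2" using n by (simp add: power2_eq_square)
      also have "\<dots> \<le> real n powr (\<kappa> * real q)" using n q by (intro powr_mono) auto
      also have "\<dots> = (real n powr \<kappa>) ^ q" using n by (simp add: powr_powr[symmetric] powr_realpow)
      also have "\<dots> \<le> m ^ q" using m by (intro power_mono) auto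
      finally show ?thesis .
    qed
    have summand: "(sqrt (m + real j) / sqrt n + 1 / (m + real j) ^ q) / ((m + real j) * sqrt (m + real j) powr p)
      \<le> f j * real n powr - \<epsilon> + 1 / (real n * real n)" if j: "j < n" for j
    proof -
      define s where "s = m + real j"
      have s: "s \<ge> m" "s \<ge> real (Suc j)" "s > 0" using m1 by (auto simp: s_def)
      have sp: "s * sqrt s powr p = s powr (1 + p / 2)"
        using s by (simp add: powr_half_sqrt[symmetric] powr_powr powr_add)
      have "sqrt s / sqrt n / (s * sqrt s powr p) = s powr (- (1 + p) / 2) * real n powr (- 1 / 2)"
      proof -
        have "sqrt s / sqrt n / (s * sqrt s powr p) = s powr (1/2) / s powr (1 + p / 2) / real n powr (1/2)"
          unfolding sp using s n by (simp add: powr_half_sqrt)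
        also have "\<dots> = s powr (1/2 - (1 + p / 2)) * real n powr (- (1/2))"
          by (simp only: powr_diff powr_minus_divide times_divide_eq_right mult_1_right)
        finally show ?thesis by (simp add: field_simps)
      qed
      also have "\<dots> \<le> real (Suc j) powr (- (1 + p) / 2) * real n powr (- 1 / 2)"
        using s p by (intro mult_right_mono powr_mono2') auto
      also have "real (Suc j) powr (- (1 + p) / 2) = f j * real (Suc j) powr (1 / 2 - \<epsilon>)"
        unfolding f_def by (simp add: powr_add[symmetric] field_simps)
      also have "f j * real (Suc j) powr (1 / 2 - \<epsilon>) * real n powr (- 1 / 2)
        \<le> f j * real n powr (1 / 2 - \<epsilon>) * real n powr (- 1 / 2)"
        using j \<epsilon> p by (intro mult_right_mono mult_left_mono powr_mono2) (auto simp: f_def)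
      also have "\<dots> = f j * real n powr - \<epsilon>" by (simp add: powr_add[symmetric] mult.assoc)
      finally have 1: "sqrt s / sqrt n / (s * sqrt s powr p) \<le> f j * real n powr - \<epsilon>" .
      have "1 \<le> s powr (1 + p / 2)" using s m1 p by (intro ge_one_powr_ge_zero) auto
      moreover have "real n * real n \<le> s ^ q" using mq power_mono[of m s q] s m1 by linarith
      ultimately have "real n * real n * 1 \<le> s ^ q * s powr (1 + p / 2)"
        using s by (intro mult_mono) auto
      then have 2: "1 / s ^ q / (s * sqrt s powr p) \<le> 1 / (real n * real n)"
        unfolding sp using n s by (simp add: divide_simps)
      show ?thesis using 1 2 unfolding s_def[symmetric] add_divide_distrib by linarith
    qed
    have "(\<Sum>k<n. lindeberg_error n m (\<lambda>k. C * (sqrt (m + real (n - Suc k)) / sqrt n + 1 / (m + real (n - Suc k)) ^ q)) k)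
      = (\<Sum>j<n. 16 * C * moments * ((sqrt (m + real j) / sqrt n + 1 / (m + real j) ^ q) / ((m + real j) * sqrt (m + real j) powr p)))"
      by (subst sum.nat_diff_reindex[symmetric]) (simp add: lindeberg_error_def mult_ac)
    also have "\<dots> \<le> (\<Sum>j<n. 16 * C * moments * (f j * real n powr - \<epsilon> + 1 / (real n * real n)))"
      using C moments_nonneg summand by (intro sum_mono mult_left_mono) auto
    also have "\<dots> = 16 * C * moments * ((\<Sum>j<n. f j) * real n powr - \<epsilon> + 1 / real n)"
      using n by (simp add: sum_distrib_left[symmetric] sum.distrib sum_distrib_right[symmetric])
    also have "\<dots> \<le> 16 * C * moments * (Z * real n powr - \<epsilon> + real n powr - \<epsilon>)"
    proof (intro mult_left_mono add_mono mult_right_mono)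
      show "(\<Sum>j<n. f j) \<le> Z" unfolding Z_def by (intro sum_le_suminf sf) (auto simp: f_def)
      have "1 / real n = real n powr - 1" using n by (simp add: powr_minus_divide)
      also have "\<dots> \<le> real n powr - \<epsilon>" using n \<epsilon> p by (intro powr_mono) auto
      finally show "1 / real n \<le> real n powr - \<epsilon>" .
    qed (use C moments_nonneg in auto)
    also have "\<dots> = 16 * C * moments * (Z + 1) * real n powr - \<epsilon>" by (simp add: algebra_simps)
    also have "\<dots> \<le> D * real n powr - \<epsilon>" by (intro mult_right_mono) (auto simp: D_def)
    finally show ?thesis .
  qed
  then show ?thesis using D by blast
qed

section \<open>The law of the walk before it becomes negative\<close>

lemma survival_eq_expectation_stay:
  "measure M {\<omega> \<in> space M. x + walk X n \<omega> \<le> b \<and> (\<forall>i\<in>{1..n}. 0 \<le> x + walk X i \<omega>)}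
    = expectation (\<lambda>\<omega>. indicator {..b} (walk X n \<omega> + x) * stay x n \<omega>)"
proof -
  have "measure M {\<omega> \<in> space M. x + walk X n \<omega> \<le> b \<and> (\<forall>i\<in>{1..n}. 0 \<le> x + walk X i \<omega>)}
    = expectation (indicator {\<omega> \<in> space M. x + walk X n \<omega> \<le> b \<and> (\<forall>i\<in>{1..n}. 0 \<le> x + walk X i \<omega>)})"
    by simp
  also have "\<dots> = expectation (\<lambda>\<omega>. indicator {..b} (walk X n \<omega> + x) * stay x n \<omega>)"
    by (intro Bochner_Integration.integral_cong) (auto simp: stay_def add.commute split: split_indicator)
  finally show ?thesis .
qed

text \<open>The scale \<open>a = n powr (1 / 2 - \<epsilon>)\<close> serves twice: as the shift of the starting point and as the
  smoothing time. The shift costs \<open>a / sqrt n = n powr - \<epsilon>\<close>, and the probability that one of \<open>n\<close> steps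
  exceeds \<open>a\<close> is of order \<open>n * a powr - (2 + \<delta>)\<close>, which equals \<open>n powr - \<epsilon>\<close> precisely for this \<open>\<epsilon>\<close>. The
  smoothing moves the walk by about \<open>sqrt a\<close>, far less than \<open>a\<close>, so its Gaussian tail is negligible.\<close>

lemma killed_walk_approx:
  assumes \<delta>: "\<delta> > 0" and X\<delta>: "integrable M (\<lambda>\<omega>. \<bar>X 1 \<omega>\<bar> powr (2 + \<delta>))" and p_eq: "p = min 1 \<delta>"
    and \<epsilon>_def: "\<epsilon> = \<delta> / (2 * (3 + \<delta>))"
  shows "\<exists>C>0. \<forall>n x b. n \<ge> 1 \<longrightarrow> x \<ge> 0 \<longrightarrow> b \<ge> 0 \<longrightarrow>
    \<bar>measure M {\<omega> \<in> space M. x + walk X n \<omega> \<le> b \<and> (\<forall>i\<in>{1..n}. 0 \<le> x + walk X i \<omega>)} - killed_heat b n x\<bar>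
    \<le> C * real n powr - \<epsilon>"
proof -
  define \<kappa> where "\<kappa> = 1 / 2 - \<epsilon>"
  have \<kappa>: "\<kappa> = 3 / (2 * (3 + \<delta>))" "\<kappa> > 0" using \<delta> by (auto simp: \<kappa>_def \<epsilon>_def field_simps)
  have \<epsilon>: "0 < \<epsilon>" "\<epsilon> < p / 2" "\<epsilon> < 1 / 2"
  proof -
    show "0 < \<epsilon>" "\<epsilon> < 1 / 2" using \<delta> by (auto simp: \<epsilon>_def field_simps)
    have "\<epsilon> < \<delta> / 2" using \<delta> by (simp add: \<epsilon>_def field_simps add_pos_pos)
    then show "\<epsilon> < p / 2" using \<open>\<epsilon> < 1 / 2\<close> by (simp add: p_eq min_def)
  qed
  \<comment> \<open>With this power all concentration and tail errors are at most of order \<open>n powr - 2\<close>.\<close>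
  define q where "q = nat \<lceil>2 / \<kappa>\<rceil>"
  have q: "\<kappa> * real q \<ge> 2"
  proof -
    have "2 / \<kappa> \<le> real q" unfolding q_def by linarith
    then show ?thesis using \<kappa>(2) by (simp add: field_simps)
  qed
  obtain C1 where C1: "C1 > 0" and conc: "\<And>n k s c. k < n \<Longrightarrow> 0 < s \<Longrightarrow> real n \<le> real k + s \<Longrightarrow>
      expectation (\<lambda>\<omega>. exp (- (walk X k \<omega> + c)\<^sup>2 / (4 * s))) \<le> C1 * (sqrt s / sqrt n + 1 / s ^ q)"
    using walk_concentration[of q] by blast
  define K where "K n m k = C1 * (sqrt (m + real (n - Suc k)) / sqrt (real n) + 1 / (m + real (n - Suc k)) ^ q)" for n m k
  obtain C2 where C2: "C2 > 0" and err: "\<And>n m. n \<ge> 1 \<Longrightarrow> m \<ge> real n powr \<kappa> \<Longrightarrow>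
      (\<Sum>k<n. lindeberg_error n m (K n m) k) \<le> C2 * real n powr - \<epsilon>"
    using lindeberg_error_sum[OF \<epsilon>(1,2) \<kappa>(2) q, of C1] C1 unfolding K_def by auto
  obtain C3 where C3: "C3 > 0" and tail: "\<And>z. z > 0 \<Longrightarrow> measure std_normal_distribution {h. z \<le> \<bar>h\<bar>} \<le> C3 / z ^ (2 * q)"
    using std_normal_tail by blast
  define C4 where "C4 = expectation (\<lambda>\<omega>. \<bar>X 1 \<omega>\<bar> powr (2 + \<delta>))"
  have C4: "C4 \<ge> 0" unfolding C4_def by simp
  define C where "C = C2 + 3 * C3 + C4 + 12"
  have C: "C > 0" using C2 C3 C4 by (simp add: C_def)
  have "\<bar>measure M {\<omega> \<in> space M. x + walk X n \<omega> \<le> b \<and> (\<forall>i\<in>{1..n}. 0 \<le> x + walk X i \<omega>)} - killed_heat b n x\<bar>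
    \<le> C * real n powr - \<epsilon>" if n: "n \<ge> 1" and x: "x \<ge> 0" and b: "b \<ge> 0" for n x b
  proof -
    define P where "P = measure M {\<omega> \<in> space M. x + walk X n \<omega> \<le> b \<and> (\<forall>i\<in>{1..n}. 0 \<le> x + walk X i \<omega>)}"
    have P: "P = expectation (\<lambda>\<omega>. indicator {..b} (walk X n \<omega> + x) * stay x n \<omega>)"
      unfolding P_def by (rule survival_eq_expectation_stay)
    define r where "r = real n powr - \<epsilon>"
    define a where "a = real n powr \<kappa>"
    have a: "a \<ge> 1" "a > 0" using n \<kappa>(2) ge_one_powr_ge_zero[of "real n" \<kappa>] by (auto simp: a_def)
    have a_sqrt: "a / sqrt n = r"
    proof -
      have "a / sqrt n = real n powr (\<kappa> - 1 / 2)"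
        using n by (simp add: a_def powr_diff powr_half_sqrt)
      then show ?thesis by (simp add: r_def \<kappa>_def)
    qed
    define Q where "Q = heat a (- a)"
    have Q: "Q \<le> C3 * r" "Q \<ge> 0"
    proof -
      show "Q \<ge> 0" unfolding Q_def by (rule heat_nonneg)
      have "Q = measure std_normal_distribution {..- sqrt a}"
        unfolding Q_def heat_def cdf_def2 using a by (simp add: real_div_sqrt)
      also have "\<dots> \<le> measure std_normal_distribution {h. sqrt a \<le> \<bar>h\<bar>}"
        by (rule std_normal.finite_measure_mono) auto
      also have "\<dots> \<le> C3 / sqrt a ^ (2 * q)" using a by (intro tail) auto
      also have "sqrt a ^ (2 * q) = real n powr (\<kappa> * real q)"
        using a n by (simp add: power_mult a_def powr_powr[symmetric] powr_realpow)
      also have "C3 / real n powr (\<kappa> * real q) = C3 * real n powr - (\<kappa> * real q)"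
        by (simp add: powr_minus_divide)
      also have "\<dots> \<le> C3 * r"
        unfolding r_def using n q \<epsilon> C3 by (intro mult_left_mono powr_mono) auto
      finally show "Q \<le> C3 * r" .
    qed
    define T where "T = expectation (\<lambda>\<omega>. indicator {y. a < \<bar>y\<bar>} (X 1 \<omega>) :: real)"
    have T: "real n * T \<le> C4 * r"
    proof -
      have [measurable]: "X 1 \<in> borel_measurable M" by (rule X_rv) simp
      have "T \<le> expectation (\<lambda>\<omega>. \<bar>X 1 \<omega>\<bar> powr (2 + \<delta>) / a powr (2 + \<delta>))"
        unfolding T_def
      proof (rule integral_mono)
        show "integrable M (\<lambda>\<omega>. indicator {y. a < \<bar>y\<bar>} (X 1 \<omega>) :: real)"
          by (rule integrable_const_bound[of _ 1]) auto
        fix \<omega>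
        show "indicator {y. a < \<bar>y\<bar>} (X 1 \<omega>) \<le> \<bar>X 1 \<omega>\<bar> powr (2 + \<delta>) / a powr (2 + \<delta>)"
          using a \<delta> powr_mono2[of "2 + \<delta>" a "\<bar>X 1 \<omega>\<bar>"] by (auto split: split_indicator)
      qed (use X\<delta> in auto)
      also have "\<dots> = C4 / a powr (2 + \<delta>)" by (simp add: C4_def)
      finally have "real n * T \<le> real n * (C4 / a powr (2 + \<delta>))" by (intro mult_left_mono) auto
      also have "\<dots> = real n powr 1 * (C4 / a powr (2 + \<delta>))" using n by simp
      also have "\<dots> = C4 * real n powr (1 - \<kappa> * (2 + \<delta>))"
        by (simp add: a_def powr_powr powr_diff)
      also have "1 - \<kappa> * (2 + \<delta>) = - \<epsilon>" using \<delta> by (simp add: \<kappa>(1) \<epsilon>_def field_simps)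
      finally show ?thesis unfolding r_def .
    qed
    have K: "expectation (\<lambda>\<omega>. exp (- (walk X k \<omega> + c)\<^sup>2 / (4 * (a + real (n - Suc k))))) \<le> K n a k" if "k < n" for k c
      unfolding K_def by (rule conc[OF that]) (use a that in \<open>auto simp: of_nat_diff\<close>)
    define S where "S = (\<Sum>k<n. lindeberg_error n a (K n a) k)"
    have S: "S \<le> C2 * r"
      unfolding S_def r_def using n by (intro err) (simp_all add: a_def)
    have ind_int: "integrable M (\<lambda>\<omega>. indicator {..b} (walk X n \<omega> + x) * stay x n \<omega>)"
      by (rule integrable_bounded_stay[of _ 1]) (auto split: split_indicator)
    have stay_int: "integrable M (\<lambda>\<omega>. Q * stay x n \<omega>)"
      using integrable_bounded_stay[of "\<lambda>_. Q" Q n 0 x n] Q by simp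
    have stay_le: "expectation (\<lambda>\<omega>. Q * stay x n \<omega>) \<le> Q"
    proof -
      have "expectation (\<lambda>\<omega>. Q * stay x n \<omega>) \<le> expectation (\<lambda>\<omega>. Q)"
        by (rule integral_mono) (use stay_int stay_bounds Q in \<open>auto intro: mult_left_le\<close>)
      then show ?thesis using prob_space by simp
    qed
    have sqa: "sqrt a / sqrt n \<le> r"
    proof -
      have "sqrt a \<le> a" using a by (simp add: real_sqrt_le_iff' power2_eq_square)
      then show ?thesis unfolding a_sqrt[symmetric] by (intro divide_right_mono) auto
    qed
    have flow0: "\<bar>flow n a b' x' x 0 - killed_heat b n x\<bar> \<le> (4 + 4 * A + 2 * B) * r"
      if "\<bar>x' - x\<bar> \<le> A * a" "\<bar>b' - b\<bar> \<le> B * a" for b' x' A B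
    proof -
      have "flow n a b' x' x 0 = killed_heat b' (real n + a) x'"
        using prob_space by (simp add: flow_def add.commute)
      moreover have "\<bar>killed_heat b' (real n + a) x' - killed_heat b' n x'\<bar> \<le> 4 * (sqrt a / sqrt n)"
        by (rule killed_heat_time_change) (use n a in auto)
      moreover have "\<bar>killed_heat b' n x' - killed_heat b n x\<bar> \<le> (4 * \<bar>x' - x\<bar> + 2 * \<bar>b' - b\<bar>) / sqrt n"
        by (rule killed_heat_lipschitz) (use n in auto)
      moreover have "(4 * \<bar>x' - x\<bar> + 2 * \<bar>b' - b\<bar>) / sqrt n \<le> (4 * (A * a) + 2 * (B * a)) / sqrt n"
        using that by (intro divide_right_mono) auto
      moreover have "(4 * (A * a) + 2 * (B * a)) / sqrt n = (4 * A + 2 * B) * r"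
        unfolding a_sqrt[symmetric] by (simp add: add_divide_distrib distrib_right)
      ultimately show ?thesis using sqa by (simp add: distrib_right)
    qed
    have lower: "P \<ge> killed_heat b n x - C * r"
    proof -
      define b' where "b' = max (b - a) 0"
      have "flow n a b' x x n \<le> expectation (\<lambda>\<omega>. indicator {..b} (walk X n \<omega> + x) * stay x n \<omega> + Q * stay x n \<omega>)"
        unfolding flow_def
      proof (intro integral_mono integrable_killed_heat Bochner_Integration.integrable_add ind_int stay_int)
        fix \<omega>
        have "killed_heat b' a (walk X n \<omega> + x) \<le> indicator {..b} (walk X n \<omega> + x) + Q"
          unfolding b'_def Q_def using a b by (intro killed_heat_le_indicator) auto
        from mult_right_mono[OF this stay_bounds(1)[of x n \<omega>]]
        show "killed_heat b' (a + real (n - n)) (walk X n \<omega> + x) * stay x n \<omega>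
          \<le> indicator {..b} (walk X n \<omega> + x) * stay x n \<omega> + Q * stay x n \<omega>"
          by (simp add: distrib_right)
      qed
      also have "\<dots> = P + expectation (\<lambda>\<omega>. Q * stay x n \<omega>)"
        unfolding P using ind_int stay_int by (rule Bochner_Integration.integral_add)
      finally have "flow n a b' x x n \<le> P + C3 * r" using stay_le Q by linarith
      moreover have "flow n a b' x x n \<ge> flow n a b' x x 0 - S"
        unfolding S_def by (rule flow_lower) (use a K in \<open>auto simp: b'_def\<close>)
      moreover have "\<bar>flow n a b' x x 0 - killed_heat b n x\<bar> \<le> 6 * r"
        using flow0[of x 0 b' 1] a b by (simp add: b'_def)
      moreover have "C * r = C2 * r + 3 * (C3 * r) + C4 * r + 12 * r" by (simp add: C_def distrib_right)
      moreover have "C3 * r \<ge> 0" "C4 * r \<ge> 0" "r \<ge> 0" using C3 C4 by (auto simp: r_def)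
      ultimately show ?thesis using S by linarith
    qed
    have upper: "P \<le> killed_heat b n x + C * r"
    proof -
      define b' where "b' = b + 2 * a"
      have stay_int3: "integrable M (\<lambda>\<omega>. 3 * (Q * stay x n \<omega>))" using stay_int by simp
      have "P \<le> expectation (\<lambda>\<omega>. killed_heat b' (a + real (n - n)) (walk X n \<omega> + (x + a)) * stay x n \<omega> + 3 * (Q * stay x n \<omega>))"
        unfolding P
      proof (intro integral_mono integrable_killed_heat Bochner_Integration.integrable_add ind_int
          stay_int3)
        fix \<omega>
        show "indicator {..b} (walk X n \<omega> + x) * stay x n \<omega>
          \<le> killed_heat b' (a + real (n - n)) (walk X n \<omega> + (x + a)) * stay x n \<omega> + 3 * (Q * stay x n \<omega>)"
        proof (cases "stay x n \<omega> = 0")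
          case False
          then have "0 \<le> walk X n \<omega> + x" "stay x n \<omega> = 1"
            using n by (auto simp: stay_def add.commute split: if_splits)
          then show ?thesis
            using indicator_le_killed_heat[of a a b "walk X n \<omega> + x"] a b
            by (simp add: b'_def Q_def add.assoc)
        qed simp
      qed
      also have "\<dots> = flow n a b' (x + a) x n + 3 * expectation (\<lambda>\<omega>. Q * stay x n \<omega>)"
        unfolding flow_def using integrable_killed_heat stay_int by (subst Bochner_Integration.integral_add) auto
      finally have "P \<le> flow n a b' (x + a) x n + 3 * (C3 * r)" using stay_le Q by linarith
      moreover have "flow n a b' (x + a) x n \<le> flow n a b' (x + a) x 0 + S + real n * T"
        unfolding S_def T_def by (rule flow_upper) (use a b x K in \<open>auto simp: b'_def\<close>)
      moreover have "\<bar>flow n a b' (x + a) x 0 - killed_heat b n x\<bar> \<le> 12 * r"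
        using flow0[of "x + a" 1 b' 2] a b by (simp add: b'_def)
      moreover have "C * r = C2 * r + 3 * (C3 * r) + C4 * r + 12 * r" by (simp add: C_def distrib_right)
      ultimately show ?thesis using S T by linarith
    qed
    show ?thesis using lower upper unfolding P_def r_def by linarith
  qed
  then show ?thesis using C by blast
qed

text \<open>Letting \<open>b\<close> tend to infinity gives the law of the exit time.\<close>

lemma survival_limit:
  assumes n: "n \<ge> 1"
    and bound: "\<And>b. b \<ge> 0 \<Longrightarrow>
      \<bar>measure M {\<omega> \<in> space M. x + walk X n \<omega> \<le> b \<and> (\<forall>i\<in>{1..n}. 0 \<le> x + walk X i \<omega>)} - killed_heat b n x\<bar> \<le> D"
  shows "\<bar>measure M {\<omega> \<in> space M. \<forall>i\<in>{1..n}. 0 \<le> x + walk X i \<omega>} - (2 * \<Phi> (x / sqrt n) - 1)\<bar> \<le> D"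
proof -
  define A where "A N = {\<omega> \<in> space M. x + walk X n \<omega> \<le> real N \<and> (\<forall>i\<in>{1..n}. 0 \<le> x + walk X i \<omega>)}" for N
  have "(\<lambda>N. measure M (A N)) \<longlonglongrightarrow> measure M (\<Union>N. A N)"
    by (rule finite_Lim_measure_incseq) (auto simp: A_def incseq_def)
  also have "(\<Union>N. A N) = {\<omega> \<in> space M. \<forall>i\<in>{1..n}. 0 \<le> x + walk X i \<omega>}"
    using real_arch_simple by (auto simp: A_def)
  finally have 1: "(\<lambda>N. measure M (A N)) \<longlonglongrightarrow> measure M {\<omega> \<in> space M. \<forall>i\<in>{1..n}. 0 \<le> x + walk X i \<omega>}" .
  have sq: "sqrt (real n) > 0" using n by simp
  have "filterlim (\<lambda>N. (x + real N) / sqrt n) at_top sequentially"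
    unfolding divide_inverse using sq
    by (intro filterlim_at_top_mult_tendsto_pos[OF tendsto_const] filterlim_tendsto_add_at_top[OF tendsto_const]
        filterlim_real_sequentially) auto
  from filterlim_compose[OF std_normal.cdf_lim_at_top_prob this]
  have 2: "(\<lambda>N. heat n (x + real N)) \<longlonglongrightarrow> 1" by (simp add: heat_def)
  have "filterlim (\<lambda>N. (- x + real N) / sqrt n) at_top sequentially"
    unfolding divide_inverse using sq
    by (intro filterlim_at_top_mult_tendsto_pos[OF tendsto_const] filterlim_tendsto_add_at_top[OF tendsto_const]
        filterlim_real_sequentially) auto
  from filterlim_compose[OF std_normal.cdf_lim_at_top_prob this]
  have "(\<lambda>N. 1 - heat n (- x + real N)) \<longlonglongrightarrow> 1 - 1"
    by (intro tendsto_intros) (simp add: heat_def)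
  then have 3: "(\<lambda>N. heat n (x - real N)) \<longlonglongrightarrow> 0"
    using heat_minus[of "real n" "x - real N" for N] by (simp add: add.commute)
  have "(\<lambda>N. killed_heat (real N) n x) \<longlonglongrightarrow> 2 * heat n x - 0 - 1"
    unfolding killed_heat_def by (intro tendsto_intros 2 3)
  then have "(\<lambda>N. \<bar>measure M (A N) - killed_heat (real N) n x\<bar>) \<longlonglongrightarrow>
    \<bar>measure M {\<omega> \<in> space M. \<forall>i\<in>{1..n}. 0 \<le> x + walk X i \<omega>} - (2 * \<Phi> (x / sqrt n) - 1)\<bar>"
    by (intro tendsto_intros 1) (simp add: heat_def)
  then show ?thesis
    by (rule LIMSEQ_le_const2) (use bound in \<open>auto simp: A_def\<close>)
qed

end

lemma exit_time_greater_iff: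
  "exit_time X x \<omega> > enat n \<longleftrightarrow> (\<forall>i\<in>{1..n}. 0 \<le> x + walk X i \<omega>)"
proof -
  let ?A = "{k. 1 \<le> k \<and> x + walk X k \<omega> < 0}"
  have "exit_time X x \<omega> \<le> enat n \<longleftrightarrow> (\<exists>k\<in>?A. k \<le> n)"
  proof
    assume le: "exit_time X x \<omega> \<le> enat n"
    then have "?A \<noteq> {}" by (auto simp: exit_time_def Inf_enat_def split: if_splits)
    then obtain k where "enat k \<in> enat ` ?A" by blast
    then have "Inf (enat ` ?A) \<in> enat ` ?A" by (rule wellorder_InfI)
    then show "\<exists>k\<in>?A. k \<le> n" using le by (auto simp: exit_time_def)
  next
    assume "\<exists>k\<in>?A. k \<le> n"
    then obtain k where "k \<in> ?A" "k \<le> n" by blast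
    then show "exit_time X x \<omega> \<le> enat n"
      unfolding exit_time_def by (intro order_trans[OF Inf_lower[of "enat k"]]) auto
  qed
  then show ?thesis by (auto simp: not_le[symmetric])
qed

text \<open>Brownian scaling.\<close>

lemma killed_heat_scale:
  assumes "r > 0"
  shows "killed_heat (t * sqrt r) r x = killed_heat t 1 (x / sqrt r)"
  using assms by (simp add: killed_heat_def heat_def add_divide_distrib diff_divide_distrib)

theorem theorem2p8:
  fixes M :: "'a measure" and X :: "nat \<Rightarrow> 'a \<Rightarrow> real" and \<sigma> \<delta> :: real
  assumes "prob_space M"
    and indep: "prob_space.indep_vars M (\<lambda>_. borel) X {1..}"
    and ident: "\<And>i. i \<ge> 1 \<Longrightarrow> distr M borel (X i) = distr M borel (X 1)"
    and mean: "integrable M (X 1)" "(LINT \<omega>|M. X 1 \<omega>) = 0"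
    and variance: "integrable M (\<lambda>\<omega>. (X 1 \<omega>)\<^sup>2)" "(LINT \<omega>|M. (X 1 \<omega>)\<^sup>2) = \<sigma>\<^sup>2" "\<sigma> > 0"
    and moment: "\<delta> > 0" "integrable M (\<lambda>\<omega>. \<bar>X 1 \<omega>\<bar> powr (2 + \<delta>))"
  shows "\<exists>c>0.
    (\<forall>n::nat. \<forall>x t :: real.
      n \<ge> 1 \<longrightarrow> x > real n powr (1/2 - \<delta> / (2 * (3 + \<delta>))) \<longrightarrow> t \<ge> 0 \<longrightarrow>
      \<bar>measure M {\<omega> \<in> space M. (x + walk X n \<omega>) / (\<sigma> * sqrt (real n)) \<le> t \<and> exit_time X x \<omega> > enat n}
        - (LBINT s:{0..t}. \<psi> s (x / (\<sigma> * sqrt (real n))))\<bar>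
      \<le> c * real n powr (- \<delta> / (2 * (3 + \<delta>)))) \<and>
    (\<forall>n::nat. \<forall>x :: real.
      n \<ge> 1 \<longrightarrow> x > real n powr (1/2 - \<delta> / (2 * (3 + \<delta>))) \<longrightarrow>
      \<bar>measure M {\<omega> \<in> space M. exit_time X x \<omega> > enat n}
        - (2 * \<Phi> (x / (\<sigma> * sqrt (real n))) - 1)\<bar>
      \<le> c * real n powr (- \<delta> / (2 * (3 + \<delta>))))"
proof -
  interpret prob_space M by fact
  have \<sigma>: "\<sigma> > 0" by fact
  have rv: "random_variable borel (X i)" if "i \<ge> 1" for i
    using indep that by (auto simp: indep_vars_def)
  \<comment> \<open>The steps are normalised to variance one; the exit time is unchanged when the starting point is
    divided by \<open>\<sigma>\<close> as well.\<close>
  define Y where "Y i \<omega> = X i \<omega> / \<sigma>" for i \<omega>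
  define p where "p = min 1 \<delta>"
  have p: "0 < p" "p \<le> 1" "p \<le> \<delta>" using moment by (auto simp: p_def)
  have Y_eq: "\<bar>Y 1 \<omega>\<bar> powr u = \<bar>X 1 \<omega>\<bar> powr u / \<sigma> powr u" for u \<omega>
    using \<sigma> by (simp add: Y_def powr_divide)
  have Y\<delta>: "integrable M (\<lambda>\<omega>. \<bar>Y 1 \<omega>\<bar> powr (2 + \<delta>))" unfolding Y_eq using moment by simp
  have Xp: "integrable M (\<lambda>\<omega>. \<bar>X 1 \<omega>\<bar> powr (2 + p))"
  proof (rule Bochner_Integration.integrable_bound)
    show "integrable M (\<lambda>\<omega>. 1 + \<bar>X 1 \<omega>\<bar> powr (2 + \<delta>))" using moment by simp
    show "(\<lambda>\<omega>. \<bar>X 1 \<omega>\<bar> powr (2 + p)) \<in> borel_measurable M" using rv[of 1] by measurable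
    show "AE \<omega> in M. norm (\<bar>X 1 \<omega>\<bar> powr (2 + p)) \<le> norm (1 + \<bar>X 1 \<omega>\<bar> powr (2 + \<delta>))"
    proof (rule AE_I2)
      fix \<omega>
      have "\<bar>X 1 \<omega>\<bar> powr (2 + p) \<le> 1 + \<bar>X 1 \<omega>\<bar> powr (2 + \<delta>)"
      proof (cases "\<bar>X 1 \<omega>\<bar> \<le> 1")
        case True
        then have "\<bar>X 1 \<omega>\<bar> powr (2 + p) \<le> 1" using p by (intro powr_le1) auto
        then show ?thesis by (rule order_trans) simp
      next
        case False
        then have "\<bar>X 1 \<omega>\<bar> powr (2 + p) \<le> \<bar>X 1 \<omega>\<bar> powr (2 + \<delta>)" using p by (intro powr_mono) auto
        then show ?thesis by simp
      qed
      then show "norm (\<bar>X 1 \<omega>\<bar> powr (2 + p)) \<le> norm (1 + \<bar>X 1 \<omega>\<bar> powr (2 + \<delta>))" by simp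
    qed
  qed
  interpret Y: unit_walk M Y p
  proof unfold_locales
    show "indep_vars (\<lambda>_. borel) Y {1..}"
      using indep_vars_compose2[OF indep, of "\<lambda>_ y. y / \<sigma>" "\<lambda>_. borel"] by (simp add: Y_def[abs_def])
    show "distr M borel (Y i) = distr M borel (Y 1)" if "i \<ge> 1" for i
    proof -
      have d: "distr M borel (Y i) = distr (distr M borel (X i)) borel (\<lambda>y. y / \<sigma>)" if "i \<ge> 1" for i
        using rv[OF that] by (subst distr_distr) (auto simp: o_def Y_def[abs_def])
      show ?thesis unfolding d[OF that] d[OF order_refl] ident[OF that] ..
    qed
    show "integrable M (Y 1)" "expectation (Y 1) = 0" "integrable M (\<lambda>\<omega>. (Y 1 \<omega>)\<^sup>2)"
      "expectation (\<lambda>\<omega>. (Y 1 \<omega>)\<^sup>2) = 1"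
      using mean variance by (simp_all add: Y_def[abs_def] power_divide)
    show "integrable M (\<lambda>\<omega>. \<bar>Y 1 \<omega>\<bar> powr (2 + p))" unfolding Y_eq using Xp by simp
  qed (use p in auto)
  have walk: "walk Y k \<omega> = walk X k \<omega> / \<sigma>" for k \<omega>
    by (simp add: walk_def Y_def sum_divide_distrib)
  define \<epsilon> where "\<epsilon> = \<delta> / (2 * (3 + \<delta>))"
  obtain C where C: "C > 0" and approx: "\<And>n x b. n \<ge> 1 \<Longrightarrow> x \<ge> 0 \<Longrightarrow> b \<ge> 0 \<Longrightarrow>
    \<bar>measure M {\<omega> \<in> space M. x + walk Y n \<omega> \<le> b \<and> (\<forall>i\<in>{1..n}. 0 \<le> x + walk Y i \<omega>)} - killed_heat b n x\<bar>
    \<le> C * real n powr - \<epsilon>"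
    using Y.killed_walk_approx[OF moment(1) Y\<delta> p_def \<epsilon>_def] by blast
  have nonneg: "0 \<le> x / \<sigma> + walk Y i \<omega> \<longleftrightarrow> 0 \<le> x + walk X i \<omega>" for x i \<omega>
    unfolding walk add_divide_distrib[symmetric] using \<sigma> by (simp add: zero_le_divide_iff)
  have exit: "exit_time X x \<omega> > enat n \<longleftrightarrow> (\<forall>i\<in>{1..n}. 0 \<le> x / \<sigma> + walk Y i \<omega>)" for n x \<omega>
    unfolding exit_time_greater_iff nonneg ..
  have pos: "x / \<sigma> \<ge> 0" if "x > real n powr (1/2 - \<delta> / (2 * (3 + \<delta>)))" for n x
  proof -
    have "x > 0" by (rule le_less_trans[OF powr_ge_zero that])
    then show ?thesis using \<sigma> by simp
  qed
  show ?thesis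
  proof (intro exI[of _ C] conjI allI impI C)
    fix n :: nat and x t :: real
    assume n: "n \<ge> 1" and x: "x > real n powr (1/2 - \<delta> / (2 * (3 + \<delta>)))" and t: "t \<ge> 0"
    have "(x + walk X n \<omega>) / (\<sigma> * sqrt (real n)) \<le> t \<longleftrightarrow> x / \<sigma> + walk Y n \<omega> \<le> t * sqrt n" for \<omega>
      unfolding walk using \<sigma> n by (simp add: field_simps)
    then have "{\<omega> \<in> space M. (x + walk X n \<omega>) / (\<sigma> * sqrt (real n)) \<le> t \<and> exit_time X x \<omega> > enat n}
      = {\<omega> \<in> space M. x / \<sigma> + walk Y n \<omega> \<le> t * sqrt n \<and> (\<forall>i\<in>{1..n}. 0 \<le> x / \<sigma> + walk Y i \<omega>)}"
      unfolding exit by simp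
    moreover have "(LBINT s:{0..t}. \<psi> s (x / (\<sigma> * sqrt (real n)))) = killed_heat (t * sqrt n) n (x / \<sigma>)"
      using n t by (simp add: psi_integral killed_heat_scale)
    ultimately show "\<bar>measure M {\<omega> \<in> space M. (x + walk X n \<omega>) / (\<sigma> * sqrt (real n)) \<le> t \<and> exit_time X x \<omega> > enat n}
        - (LBINT s:{0..t}. \<psi> s (x / (\<sigma> * sqrt (real n))))\<bar>
      \<le> C * real n powr (- \<delta> / (2 * (3 + \<delta>)))"
      using approx[OF n pos[OF x], of "t * sqrt n"] t by (simp add: \<epsilon>_def)
  next
    fix n :: nat and x :: real
    assume n: "n \<ge> 1" and x: "x > real n powr (1/2 - \<delta> / (2 * (3 + \<delta>)))"
    have "\<bar>measure M {\<omega> \<in> space M. \<forall>i\<in>{1..n}. 0 \<le> x / \<sigma> + walk Y i \<omega>} - (2 * \<Phi> (x / \<sigma> / sqrt n) - 1)\<bar>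
      \<le> C * real n powr - \<epsilon>"
      by (rule Y.survival_limit[OF n approx[OF n pos[OF x]]])
    then show "\<bar>measure M {\<omega> \<in> space M. exit_time X x \<omega> > enat n}
        - (2 * \<Phi> (x / (\<sigma> * sqrt (real n))) - 1)\<bar>
      \<le> C * real n powr (- \<delta> / (2 * (3 + \<delta>)))"
      unfolding exit by (simp add: \<epsilon>_def)
  qed
qed

end
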